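(* Let $p\in[1,\infty]$, let $x:[0,\infty)\to\mathbb{R}$ be continuous, and let $\Pi=(\pi_n)_n$ be a fixed sequence of partitions of $[0,\infty)$ such that $O_t(x,\pi_n)\to0$ as $n\to\infty$ for all $t\in[0,\infty)$. Let $x\in\mathcal{L}_p^\Pi$ and let $f:\mathbb{R}\to\mathbb{R}$ be $C^1$ and strictly monotone. Then $f(x)=f\circ x\in\mathcal{L}_p^\Pi$, and the pathwise local times of $x$ and $f(x)$ along $\Pi$ are related by $$L^{f(x)}_t(f(u))=|f'(u)|\,L^x_t(u).$$
   Context: A partition of $[0,\infty)$ is a sequence $\pi=(t_k)_{k\in\mathbb{N}}$ in $[0,\infty]$ with $t_0=0$, $t_k<t_{k+1}$ whenever $t_{k+1}<\infty$, and $\lim_k t_k=\infty$. For continuous $x$, $O_t(x,\pi):=\max\{|x(b)-x(a)|:a,b\in[t_k,t_{k+1})\cap[0,t]\text{ for some }k\}$ (understood as a supremum). For $a,b\in\mathbb{R}$ let $[\![a,b)\!)$ denote $[a,b)$ if $a\le b$ and $[b,a)$ if $a>b$. The discrete local time of $x$ along $\pi$ is $$L^{x,\pi}_t(u):=2\sum_{t_j\in\pi}\mathbf{1}_{[\![x_{t_j\wedge t},\,x_{t_{j+1}\wedge t})\!)}(u)\,|x_{t_{j+1}\wedge t}-u|.$$ $\mathcal{L}_p^\Pi$ is the set of continuous $x:[0,\infty)\to\mathbb{R}$ with $O_t(x,\pi_n)\to0$ for all $t$ such that, for all $t\in[0,\infty)$, $(L^{x,\pi_n}_t)_n$ converges weakly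 in $L^p(\mathbb{R},du)$ (weakly$^*$ in $L^\infty$ if $p=\infty$) to some $L^x_t\in L^p$, and $t\mapsto L^x_t\in L^p$ is continuous for the weak (resp. weak$^*$) topology. $L^x_t(u)$ is called the pathwise local time of $x$ along $\Pi$. Since $L_t$ is an element of $L^p$, the identity between local times is understood for each $t$, for a.e. $u$ and up to the choice of representatives (i.e. for a suitable representative of $L^{f(x)}_t$). *)

theory Defs
  imports "HOL-Analysis.Analysis"
begin

text \<open>Paths on $[0,\infty)$ are total functions \<open>real \<Rightarrow> real\<close>; nothing below evaluates
  them at a negative time.\<close>

definition is_partition :: "(nat \<Rightarrow> ennreal) \<Rightarrow> bool" where
  "is_partition \<pi> \<longleftrightarrow>
     \<pi> 0 = 0 \<and> (\<forall>k. \<pi> (Suc k) < \<infinity> \<longrightarrow> \<pi> k < \<pi> (Suc k)) \<and> \<pi> \<longlonglongrightarrow> \<infinity>"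

text \<open>For a continuous path the supremum is over a nonempty bounded set, so the real-valued
  \<open>Sup\<close> is the true supremum.\<close>

definition osc :: "real \<Rightarrow> (real \<Rightarrow> real) \<Rightarrow> (nat \<Rightarrow> ennreal) \<Rightarrow> real" where
  "osc t x \<pi> = Sup {\<bar>x b - x a\<bar> | a b. \<exists>k. \<forall>s\<in>{a, b}.
     0 \<le> s \<and> s \<le> t \<and> \<pi> k \<le> ennreal s \<and> ennreal s < \<pi> (Suc k)}"

definition half_open :: "real \<Rightarrow> real \<Rightarrow> real set" where
  "half_open a b = (if a \<le> b then {a..<b} else {b..<a})"

definition stopped :: "(nat \<Rightarrow> ennreal) \<Rightarrow> real \<Rightarrow> nat \<Rightarrow> real" where
  "stopped \<pi> t j = enn2real (min (\<pi> j) (ennreal t))"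

text \<open>The series has finitely many nonzero terms, since the interval is empty as soon as
  \<open>\<pi> j \<ge> t\<close>.\<close>

definition discrete_local_time ::
    "(nat \<Rightarrow> ennreal) \<Rightarrow> (real \<Rightarrow> real) \<Rightarrow> real \<Rightarrow> real \<Rightarrow> real" where
  "discrete_local_time \<pi> x t u =
     2 * (\<Sum>j. indicator (half_open (x (stopped \<pi> t j)) (x (stopped \<pi> t (Suc j)))) u
               * \<bar>x (stopped \<pi> t (Suc j)) - u\<bar>)"

text \<open>Elements of $L^p(\mathbb{R},du)$ are represented by Borel functions; membership does not
  depend on the representative.\<close>

definition Lp :: "ennreal \<Rightarrow> (real \<Rightarrow> real) set" where
  "Lp p = {h \<in> borel_measurable lborel.
     if p = \<infinity> then \<exists>C. AE u in lborel. \<bar>h u\<bar> \<le> C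
     else integrable lborel (\<lambda>u. \<bar>h u\<bar> powr enn2real p)}"

text \<open>The functionals that generate the topology on $L^p$: for finite \<open>p\<close> all
  continuous linear functionals (weak topology), for \<open>p = \<infinity>\<close> the pairings with $L^1$ (weak-star
  topology). The bound by the $L^p$ norm makes a functional agree on almost everywhere equal functions.\<close>

definition Lp_functionals :: "ennreal \<Rightarrow> ((real \<Rightarrow> real) \<Rightarrow> real) set" where
  "Lp_functionals p =
     (if p = \<infinity> then {\<phi>. \<exists>g\<in>Lp 1. \<forall>h\<in>Lp p. \<phi> h = (\<integral>u. h u * g u \<partial>lborel)}
      else {\<phi>. (\<forall>h\<in>Lp p. \<forall>k\<in>Lp p. \<forall>a b. \<phi> (\<lambda>u. a * h u + b * k u) = a * \<phi> h + b * \<phi> k) \<and>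
               (\<exists>C. \<forall>h\<in>Lp p.
                  \<bar>\<phi> h\<bar> \<le> C * (\<integral>u. \<bar>h u\<bar> powr enn2real p \<partial>lborel) powr (1 / enn2real p))})"

definition Lp_weak_lim :: "ennreal \<Rightarrow> (nat \<Rightarrow> real \<Rightarrow> real) \<Rightarrow> (real \<Rightarrow> real) \<Rightarrow> bool" where
  "Lp_weak_lim p H h \<longleftrightarrow>
     (\<forall>n. H n \<in> Lp p) \<and> h \<in> Lp p \<and> (\<forall>\<phi>\<in>Lp_functionals p. (\<lambda>n. \<phi> (H n)) \<longlonglongrightarrow> \<phi> h)"

text \<open>\<open>is_local_time p \<pi>s x L\<close>: the path \<open>x\<close> belongs to the class of paths with an $L^p$ local time
  along \<open>\<pi>s\<close>, and \<open>L t\<close> is, for each \<open>t \<ge> 0\<close>, a representative of its local time at \<open>t\<close>.\<close>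

definition is_local_time ::
    "ennreal \<Rightarrow> (nat \<Rightarrow> nat \<Rightarrow> ennreal) \<Rightarrow> (real \<Rightarrow> real) \<Rightarrow> (real \<Rightarrow> real \<Rightarrow> real) \<Rightarrow> bool" where
  "is_local_time p \<pi>s x L \<longleftrightarrow>
     continuous_on {0..} x \<and>
     (\<forall>t\<ge>0. (\<lambda>n. osc t x (\<pi>s n)) \<longlonglongrightarrow> 0) \<and>
     (\<forall>t\<ge>0. Lp_weak_lim p (\<lambda>n. discrete_local_time (\<pi>s n) x t) (L t)) \<and>
     (\<forall>\<phi>\<in>Lp_functionals p. continuous_on {0..} (\<lambda>t. \<phi> (L t)))"

definition local_time_class ::
    "ennreal \<Rightarrow> (nat \<Rightarrow> nat \<Rightarrow> ennreal) \<Rightarrow> (real \<Rightarrow> real) set" where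
  "local_time_class p \<pi>s = {x. \<exists>L. is_local_time p \<pi>s x L}"

end

theory Submission
  imports Defs
begin

text \<open>If \<open>u\<close> lies between two successive values \<open>a, b\<close> of the path, then by the mean value
  theorem \<open>\<bar>f b - f u\<bar>\<close> is \<open>\<bar>b - u\<bar>\<close> times \<open>\<bar>f'\<bar>\<close> at a point close to \<open>u\<close>. Hence the
  discrete local time of \<open>f \<circ> x\<close> at \<open>f u\<close> is \<open>\<bar>f' u\<bar>\<close> times that of \<open>x\<close> at \<open>u\<close>, up to
  \<open>\<epsilon>\<close> times the latter. Here \<open>\<epsilon>\<close> tends to zero with the oscillation, by uniform continuity of
  \<open>f'\<close> on a compact interval that contains the path (lemma
  \<open>discrete_local_time_compose\<close>). What remains is to pass to weak limits.

  The limit is transported along \<open>f\<close> by the operator \<open>pushforward\<close>, cut off to a compact interval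
  that contains the range of the path. By the change of variables formula it is bounded on \<open>L^p\<close>,
  so its composition with an admissible functional is again admissible (lemma
  \<open>pushforward_functional\<close>). This gives the weak convergence of the transported discrete local times
  and, in the same way, the weak continuity in time.

  The error is dominated by \<open>\<epsilon>\<close> times a nonnegative weakly convergent sequence, and such a
  perturbation vanishes weakly (lemma \<open>functional_dominated_tendsto_zero\<close>). For finite \<open>p\<close> this
  rests on a bound of the sequence in norm: otherwise a series of integrals against dual powers of
  its members defines a bounded functional that is unbounded along the sequence (lemma
  \<open>weakly_bounded_imp_norm_bounded\<close>).

  Finally, weak limits are unique almost everywhere (lemma \<open>Lp_weak_lim_unique\<close>). This identifies an
  arbitrary local time of \<open>f \<circ> x\<close> with the transported one, and shows that the local time of \<open>x\<close>
  vanishes outside the range of the path, where the cut-off would otherwise be visible.\<close>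

section \<open>Functionals on Lp and weak limits\<close>

lemma continuous_on_Icc_bounded:
  fixes f :: "real \<Rightarrow> real"
  assumes "continuous_on {a..b} f"
  obtains B where "0 \<le> B" "\<And>u. u \<in> {a..b} \<Longrightarrow> \<bar>f u\<bar> \<le> B"
proof -
  have "bounded (f ` {a..b})"
    using assms by (intro compact_imp_bounded compact_continuous_image) auto
  then obtain B where B: "\<forall>y\<in>f ` {a..b}. norm y \<le> B"
    unfolding bounded_iff by blast
  show ?thesis
    by (rule that[of "\<bar>B\<bar>"]) (use B in force)+
qed

lemma Lp_finite_iff:
  assumes "p \<noteq> \<infinity>"
  shows "h \<in> Lp p \<longleftrightarrow> h \<in> borel_measurable borel \<and>
    integrable lborel (\<lambda>u. \<bar>h u\<bar> powr enn2real p)"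
  using assms by (simp add: Lp_def)

lemma Lp_measurable: "h \<in> Lp p \<Longrightarrow> h \<in> borel_measurable borel"
  by (simp add: Lp_def)

lemma one_le_enn2real: "1 \<le> p \<Longrightarrow> p \<noteq> \<infinity> \<Longrightarrow> 1 \<le> enn2real p"
  by (metis enn2real_1 enn2real_mono infinity_ennreal_def top.not_eq_extremum)

lemma powr_add_le:
  fixes a b r :: real
  assumes "0 \<le> r"
  shows "\<bar>a + b\<bar> powr r \<le> 2 powr r * (\<bar>a\<bar> powr r + \<bar>b\<bar> powr r)"
proof -
  have "\<bar>a + b\<bar> powr r \<le> (2 * max \<bar>a\<bar> \<bar>b\<bar>) powr r"
    using assms by (intro powr_mono2) auto
  also have "\<dots> = 2 powr r * (max \<bar>a\<bar> \<bar>b\<bar>) powr r"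
    by (simp add: powr_mult)
  also have "\<dots> \<le> 2 powr r * (\<bar>a\<bar> powr r + \<bar>b\<bar> powr r)"
    by (intro mult_left_mono) (auto simp: max_def)
  finally show ?thesis .
qed

lemma Lp_lincomb:
  assumes "1 \<le> p" "h \<in> Lp p" "k \<in> Lp p"
  shows "(\<lambda>u. a * h u + b * k u) \<in> Lp p"
proof (cases "p = \<infinity>")
  case True
  then obtain C D where C: "AE u in lborel. \<bar>h u\<bar> \<le> C" and D: "AE u in lborel. \<bar>k u\<bar> \<le> D"
    using assms by (auto simp: Lp_def)
  have "AE u in lborel. \<bar>a * h u + b * k u\<bar> \<le> \<bar>a\<bar> * C + \<bar>b\<bar> * D"
    using C D
  proof eventually_elim
    case (elim u)
    have "\<bar>a * h u + b * k u\<bar> \<le> \<bar>a\<bar> * \<bar>h u\<bar> + \<bar>b\<bar> * \<bar>k u\<bar>"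
      by (metis abs_mult abs_triangle_ineq)
    also have "\<dots> \<le> \<bar>a\<bar> * C + \<bar>b\<bar> * D"
      using elim by (intro add_mono mult_left_mono) auto
    finally show ?case .
  qed
  moreover have "(\<lambda>u. a * h u + b * k u) \<in> borel_measurable borel"
    using assms Lp_measurable by measurable
  ultimately show ?thesis
    using True by (auto simp: Lp_def)
next
  case False
  let ?r = "enn2real p"
  have r: "0 \<le> ?r" by simp
  note [measurable] = assms(2,3)[THEN Lp_measurable]
  have ih: "integrable lborel (\<lambda>u. \<bar>h u\<bar> powr ?r)" and ik: "integrable lborel (\<lambda>u. \<bar>k u\<bar> powr ?r)"
    using assms False by (auto simp: Lp_finite_iff)
  have "integrable lborel (\<lambda>u. \<bar>a * h u + b * k u\<bar> powr ?r)"
  proof (rule Bochner_Integration.integrable_bound)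
    show "integrable lborel (\<lambda>u. 2 powr ?r *
        (\<bar>a\<bar> powr ?r * \<bar>h u\<bar> powr ?r + \<bar>b\<bar> powr ?r * \<bar>k u\<bar> powr ?r))"
      using ih ik by auto
    show "AE u in lborel. norm (\<bar>a * h u + b * k u\<bar> powr ?r) \<le> norm (2 powr ?r *
        (\<bar>a\<bar> powr ?r * \<bar>h u\<bar> powr ?r + \<bar>b\<bar> powr ?r * \<bar>k u\<bar> powr ?r))"
      using powr_add_le[OF r, of "a * h u" "b * k u" for u]
      by (intro AE_I2) (simp add: powr_mult abs_mult)
  qed measurable
  then show ?thesis
    using False by (simp add: Lp_finite_iff)
qed

text \<open>A form of Young's inequality without the sharp constants: replace the smaller of the two numbers by
  the larger one.\<close>

lemma mult_powr_le:
  fixes a k r :: real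
  assumes "1 \<le> r" "0 \<le> a" "0 \<le> k"
  shows "a * k powr (r - 1) \<le> a powr r + k powr r"
proof -
  have *: "z * z powr (r - 1) = z powr r" if "0 \<le> z" for z :: real
    using powr_mult_base[OF that, of "r - 1"] by simp
  show ?thesis
  proof (cases "a \<le> k")
    case True
    then have "a * k powr (r - 1) \<le> k * k powr (r - 1)"
      by (intro mult_right_mono) auto
    then show ?thesis using * assms by (simp add: add_increasing)
  next
    case False
    then have "a * k powr (r - 1) \<le> a * a powr (r - 1)"
      using assms by (intro mult_left_mono powr_mono2) auto
    then show ?thesis using * assms by (simp add: add_increasing2)
  qed
qed

text \<open>Hoelder's inequality up to a constant, for \<open>g\<close> dominated by the dual power of a function
  \<open>k\<close>. The bound \<open>1 + \<integral> k powr r\<close> is additive at first, as it comes from the previous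
  lemma; applied to the multiple of \<open>h\<close> that has norm one, it becomes homogeneous in \<open>h\<close>.\<close>

lemma
  fixes h g k :: "real \<Rightarrow> real" and r :: real
  assumes r: "1 \<le> r"
    and [measurable]: "h \<in> borel_measurable borel" "g \<in> borel_measurable borel"
    and h: "integrable lborel (\<lambda>u. \<bar>h u\<bar> powr r)"
    and k: "integrable lborel (\<lambda>u. k u powr r)" "\<And>u. 0 \<le> k u"
    and g: "\<And>u. \<bar>g u\<bar> \<le> k u powr (r - 1)"
  shows integrable_mult_powr: "integrable lborel (\<lambda>u. h u * g u)"
    and integral_mult_powr_bound: "\<bar>\<integral>u. h u * g u \<partial>lborel\<bar>
      \<le> (1 + (\<integral>u. k u powr r \<partial>lborel)) * (\<integral>u. \<bar>h u\<bar> powr r \<partial>lborel) powr (1 / r)"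
proof -
  have bound: "\<bar>s * h u * g u\<bar> \<le> s powr r * \<bar>h u\<bar> powr r + k u powr r" if "0 \<le> s" for s u
  proof -
    have "\<bar>s * h u * g u\<bar> \<le> \<bar>s * h u\<bar> * k u powr (r - 1)"
      using g by (simp add: abs_mult mult_left_mono)
    also have "\<dots> \<le> \<bar>s * h u\<bar> powr r + k u powr r"
      using r k by (intro mult_powr_le) auto
    finally show ?thesis using that by (simp add: abs_mult powr_mult)
  qed
  show int: "integrable lborel (\<lambda>u. h u * g u)"
  proof (rule Bochner_Integration.integrable_bound)
    show "integrable lborel (\<lambda>u. \<bar>h u\<bar> powr r + k u powr r)"
      using h k by simp
    show "AE u in lborel. norm (h u * g u) \<le> norm (\<bar>h u\<bar> powr r + k u powr r)"
      using bound[of 1] by simp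
  qed measurable
  let ?A = "\<integral>u. \<bar>h u\<bar> powr r \<partial>lborel" and ?B = "\<integral>u. k u powr r \<partial>lborel"
  have A: "0 \<le> ?A" by simp
  show "\<bar>\<integral>u. h u * g u \<partial>lborel\<bar> \<le> (1 + ?B) * ?A powr (1 / r)"
  proof (cases "?A = 0")
    case True
    then have "AE u in lborel. \<bar>h u\<bar> powr r = 0"
      using integral_nonneg_eq_0_iff_AE[OF h] by simp
    then have "AE u in lborel. h u * g u = 0"
      by eventually_elim simp
    then have "(\<integral>u. h u * g u \<partial>lborel) = 0"
      by (rule integral_eq_zero_AE)
    then show ?thesis using True r by simp
  next
    case False
    \<comment> \<open>the factor that normalizes \<open>h\<close>\<close>
    define s where "s = ?A powr (- 1 / r)"
    have "s powr r = ?A powr (- 1)"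
      using r by (simp add: s_def powr_powr)
    then have s: "0 < s" "s powr r = 1 / ?A"
      using False A by (auto simp: s_def powr_neg_one order_less_le)
    have "\<bar>\<integral>u. s * h u * g u \<partial>lborel\<bar> \<le> (\<integral>u. \<bar>s * h u * g u\<bar> \<partial>lborel)"
      using integral_norm_bound[of lborel "\<lambda>u. s * h u * g u"] by simp
    also have "\<dots> \<le> (\<integral>u. s powr r * \<bar>h u\<bar> powr r + k u powr r \<partial>lborel)"
    proof (rule integral_mono)
      show "integrable lborel (\<lambda>u. \<bar>s * h u * g u\<bar>)"
        using int by (simp add: mult.assoc)
    qed (use h k bound[of s] s(1) in auto)
    also have "\<dots> = 1 + ?B"
      using h k s False by simp
    finally have le: "s * \<bar>\<integral>u. h u * g u \<partial>lborel\<bar> \<le> 1 + ?B"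
      using s by (simp add: mult.assoc abs_mult)
    have "\<bar>\<integral>u. h u * g u \<partial>lborel\<bar> = s * \<bar>\<integral>u. h u * g u \<partial>lborel\<bar> * (1 / s)"
      using s by simp
    also have "\<dots> \<le> (1 + ?B) * (1 / s)"
      using le s by (intro mult_right_mono) auto
    also have "1 / s = ?A powr (1 / r)"
      by (simp add: s_def powr_minus_divide)
    finally show ?thesis .
  qed
qed

lemma finite_functional_iff:
  assumes "p \<noteq> \<infinity>"
  shows "\<phi> \<in> Lp_functionals p \<longleftrightarrow>
      (\<forall>h\<in>Lp p. \<forall>k\<in>Lp p. \<forall>a b. \<phi> (\<lambda>u. a * h u + b * k u) = a * \<phi> h + b * \<phi> k) \<and>
      (\<exists>C\<ge>0. \<forall>h\<in>Lp p. \<bar>\<phi> h\<bar> \<le> C * (\<integral>u. \<bar>h u\<bar> powr enn2real p \<partial>lborel) powr (1 / enn2real p))"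
    (is "_ \<longleftrightarrow> ?lin \<and> (\<exists>C\<ge>0. ?B C)")
proof -
  have "?B \<bar>C\<bar>" if "?B C" for C
    using that by (meson abs_ge_self mult_right_mono order_trans powr_ge_zero)
  then have "(\<exists>C. ?B C) \<longleftrightarrow> (\<exists>C\<ge>0. ?B C)"
    by (metis abs_ge_zero)
  then show ?thesis
    using assms unfolding Lp_functionals_def by simp
qed

lemma functional_lincomb:
  assumes "\<phi> \<in> Lp_functionals p" "1 \<le> p" "h \<in> Lp p" "k \<in> Lp p"
  shows "\<phi> (\<lambda>u. a * h u + b * k u) = a * \<phi> h + b * \<phi> k"
proof (cases "p = \<infinity>")
  case True
  then obtain g where g: "g \<in> Lp 1" "\<And>h. h \<in> Lp p \<Longrightarrow> \<phi> h = (\<integral>u. h u * g u \<partial>lborel)"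
    using assms by (auto simp: Lp_functionals_def)
  have int: "integrable lborel (\<lambda>u. h u * g u)" if h: "h \<in> Lp p" for h
  proof -
    obtain C where C: "AE u in lborel. \<bar>h u\<bar> \<le> C"
      using h True by (auto simp: Lp_def)
    note [measurable] = Lp_measurable[OF h] Lp_measurable[OF g(1)]
    show ?thesis
    proof (rule Bochner_Integration.integrable_bound)
      show "integrable lborel (\<lambda>u. C * \<bar>g u\<bar>)"
        using g(1) by (simp add: Lp_def)
      show "AE u in lborel. norm (h u * g u) \<le> norm (C * \<bar>g u\<bar>)"
        using C by eventually_elim (auto simp: abs_mult intro!: mult_right_mono)
    qed measurable
  qed
  have "\<phi> (\<lambda>u. a * h u + b * k u) = (\<integral>u. a * (h u * g u) + b * (k u * g u) \<partial>lborel)"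
    using g(2)[OF Lp_lincomb[OF assms(2-4)]] by (simp add: algebra_simps)
  then show ?thesis
    using int assms g(2) by simp
next
  case False
  then show ?thesis
    using assms by (simp add: finite_functional_iff)
qed

text \<open>These integrals serve as norming functionals in the uniform boundedness principle and as test
  functionals for the uniqueness of weak limits.\<close>

lemma integral_functional:
  fixes g k :: "real \<Rightarrow> real"
  assumes p: "1 \<le> p" "p \<noteq> \<infinity>"
    and [measurable]: "g \<in> borel_measurable borel"
    and k: "k \<in> Lp p" "\<And>u. 0 \<le> k u"
    and g: "\<And>u. \<bar>g u\<bar> \<le> k u powr (enn2real p - 1)"
  shows "(\<lambda>h. \<integral>u. h u * g u \<partial>lborel) \<in> Lp_functionals p"
proof -
  let ?r = "enn2real p"
  have r: "1 \<le> ?r" using one_le_enn2real p by blast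
  have k': "integrable lborel (\<lambda>u. k u powr ?r)"
    using k p by (simp add: Lp_finite_iff)
  have int: "integrable lborel (\<lambda>u. h u * g u)"
    and bd: "\<bar>\<integral>u. h u * g u \<partial>lborel\<bar>
        \<le> (1 + (\<integral>u. k u powr ?r \<partial>lborel)) * (\<integral>u. \<bar>h u\<bar> powr ?r \<partial>lborel) powr (1 / ?r)"
    if "h \<in> Lp p" for h
    using that p k' k g r
    by (auto simp: Lp_finite_iff intro!: integrable_mult_powr[where k=k] integral_mult_powr_bound)
  have "(\<integral>u. (a * h u + b * l u) * g u \<partial>lborel)
      = a * (\<integral>u. h u * g u \<partial>lborel) + b * (\<integral>u. l u * g u \<partial>lborel)"
    if "h \<in> Lp p" "l \<in> Lp p" for h l a b
  proof -
    have "(\<integral>u. (a * h u + b * l u) * g u \<partial>lborel) = (\<integral>u. a * (h u * g u) + b * (l u * g u) \<partial>lborel)"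
      by (simp add: algebra_simps)
    then show ?thesis using int that by simp
  qed
  moreover have "0 \<le> 1 + (\<integral>u. k u powr ?r \<partial>lborel)"
    by (intro add_nonneg_nonneg integral_nonneg) auto
  ultimately show ?thesis
    using bd p unfolding finite_functional_iff[OF p(2)] by blast
qed

text \<open>The uniform boundedness principle for nonnegative functions. Positivity allows a gliding hump
  without cancellation: if the norms are unbounded, choose \<open>H (m k)\<close> of norm at least \<open>4 ^ k\<close>. It
  has a positive norming functional \<open>G k\<close>, and the sum of the functionals \<open>(1/2)^k * G k\<close> is
  bounded, but its value at \<open>H (m k)\<close> is at least \<open>2 ^ k\<close>.\<close>

lemma weakly_bounded_imp_norm_bounded:
  assumes p: "1 \<le> p" "p \<noteq> \<infinity>"
    and H: "\<And>n. H n \<in> Lp p" "\<And>n u. 0 \<le> H n u"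
    and bd: "\<And>\<phi>. \<phi> \<in> Lp_functionals p \<Longrightarrow> Bseq (\<lambda>n. \<phi> (H n))"
  shows "\<exists>B. \<forall>n. (\<integral>u. \<bar>H n u\<bar> powr enn2real p \<partial>lborel) \<le> B"
proof (rule ccontr)
  assume unb: "\<not> ?thesis"
  let ?r = "enn2real p"
  have r: "1 \<le> ?r" using one_le_enn2real p by blast
  note [measurable] = H(1)[THEN Lp_measurable]
  define A where "A n = (\<integral>u. \<bar>H n u\<bar> powr ?r \<partial>lborel)" for n
  have "\<exists>n. (4 ^ k) powr ?r < A n" for k
    using unb by (auto simp: A_def not_le)
  then obtain m where m: "\<And>k. (4 ^ k) powr ?r < A (m k)"
    by metis
  define N where "N k = A (m k) powr (1 / ?r)" for k
  have A_pos: "0 < A (m k)" for k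
    using m[of k] by (meson le_less_trans powr_ge_zero)
  have N: "4 ^ k \<le> N k" "0 < N k" "N k powr ?r = A (m k)" for k
  proof -
    have "((4 ^ k) powr ?r) powr (1 / ?r) \<le> N k"
      unfolding N_def using m[of k] r by (intro powr_mono2) auto
    then show "4 ^ k \<le> N k"
      using r by (simp add: powr_powr)
    show "0 < N k" "N k powr ?r = A (m k)"
      using A_pos[of k] r by (auto simp: N_def powr_powr)
  qed
  \<comment> \<open>the normalized hump; its dual power \<open>g k\<close> norms it\<close>
  define K where "K k u = H (m k) u / N k" for k u
  define g where "g k u = K k u powr (?r - 1)" for k u
  define G where "G k h = (\<integral>u. h u * g k u \<partial>lborel)" for k h
  have K0: "0 \<le> K k u" for k u
    using H(2) N(2)[of k] by (simp add: K_def)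
  have KLp: "K k \<in> Lp p" for k
    using Lp_lincomb[OF p(1) H(1) H(1), of "1 / N k" "m k" 0 "m k"] by (simp add: K_def[abs_def])
  note [measurable] = KLp[THEN Lp_measurable]
  have gm [measurable]: "g k \<in> borel_measurable borel" for k
    unfolding g_def by measurable
  have K1: "(\<integral>u. K k u powr ?r \<partial>lborel) = 1" for k
  proof -
    have "(\<integral>u. K k u powr ?r \<partial>lborel) = (\<integral>u. \<bar>H (m k) u\<bar> powr ?r / N k powr ?r \<partial>lborel)"
      using H(2) N(2)[of k] by (intro Bochner_Integration.integral_cong) (auto simp: K_def powr_divide)
    also have "\<dots> = A (m k) / N k powr ?r"
      by (simp add: A_def)
    finally show ?thesis
      using A_pos[of k] N by simp
  qed
  define nrm where "nrm h = (\<integral>u. \<bar>h u\<bar> powr ?r \<partial>lborel) powr (1 / ?r)" for h :: "real \<Rightarrow> real"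
  \<comment> \<open>the constant is \<open>2 = 1 + 1\<close>, since \<open>K k\<close> has norm one\<close>
  have G_bound: "\<bar>G k h\<bar> \<le> 2 * nrm h" if "h \<in> Lp p" for k h
  proof -
    have "\<bar>G k h\<bar> \<le> (1 + (\<integral>u. K k u powr ?r \<partial>lborel)) * nrm h"
      unfolding G_def nrm_def
      using that KLp[of k] K0 p r
      by (intro integral_mult_powr_bound[where k = "K k"]) (auto simp: Lp_finite_iff g_def)
    then show ?thesis by (simp add: K1)
  qed
  have G_fun: "G k \<in> Lp_functionals p" for k
    unfolding G_def
    by (rule integral_functional[where k = "K k"]) (use p KLp K0 in \<open>auto simp: g_def\<close>)
  have geo: "(\<lambda>k. (1 / 2) ^ k * (2 * c)) sums (4 * c)" for c :: real
    using sums_mult2[OF geometric_sums[of "1 / 2 :: real"], of "2 * c"] by simp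
  define \<phi> where "\<phi> h = (\<Sum>k. (1 / 2) ^ k * G k h)" for h
  have term_bound: "norm ((1 / 2) ^ k * G k h) \<le> (1 / 2) ^ k * (2 * nrm h)" if "h \<in> Lp p" for k h
    using G_bound[OF that, of k] by (simp add: abs_mult)
  have sm: "summable (\<lambda>k. (1 / 2) ^ k * G k h)" if "h \<in> Lp p" for h
    using summable_comparison_test'[OF sums_summable[OF geo] term_bound[OF that]] by simp
  have "\<phi> (\<lambda>u. a * h u + b * k u) = a * \<phi> h + b * \<phi> k" if hk: "h \<in> Lp p" "k \<in> Lp p" for h k a b
  proof -
    have "\<phi> (\<lambda>u. a * h u + b * k u)
        = (\<Sum>j. a * ((1 / 2) ^ j * G j h) + b * ((1 / 2) ^ j * G j k))"
      unfolding \<phi>_def functional_lincomb[OF G_fun p(1) hk] by (simp add: algebra_simps)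
    also have "\<dots> = a * \<phi> h + b * \<phi> k"
      unfolding \<phi>_def using sm[OF hk(1)] sm[OF hk(2)]
      by (subst suminf_add[symmetric]) (auto simp: suminf_mult intro!: summable_mult)
    finally show ?thesis .
  qed
  moreover have "\<bar>\<phi> h\<bar> \<le> 4 * nrm h" if "h \<in> Lp p" for h
  proof -
    have "norm (\<phi> h) \<le> (\<Sum>k. (1 / 2) ^ k * (2 * nrm h))"
      unfolding \<phi>_def using term_bound[OF that] by (rule norm_suminf_le) (rule sums_summable[OF geo])
    then show ?thesis
      using sums_unique[OF geo, of "nrm h"] by simp
  qed
  ultimately have "\<phi> \<in> Lp_functionals p"
    unfolding finite_functional_iff[OF p(2)] nrm_def
    by (intro conjI exI[of _ 4]) auto
  then obtain M where M: "\<And>n. \<bar>\<phi> (H n)\<bar> \<le> M"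
    using bd[of \<phi>] unfolding Bseq_def by auto
  have "2 ^ k \<le> M" for k
  proof -
    have "N k * K k u powr ?r = H (m k) u * g k u" for u
    proof -
      have "N k * K k u = H (m k) u"
        using N(2)[of k] by (simp add: K_def)
      moreover have "K k u powr ?r = K k u * g k u"
        using powr_mult_base[OF K0[of k u], of "?r - 1"] by (simp add: g_def)
      ultimately show ?thesis by (simp add: mult.assoc[symmetric])
    qed
    then have "G k (H (m k)) = (\<integral>u. N k * K k u powr ?r \<partial>lborel)"
      by (simp add: G_def)
    then have "G k (H (m k)) = N k"
      by (simp add: K1)
    then have "(1 / 2) ^ k * 4 ^ k \<le> (1 / 2) ^ k * G k (H (m k))"
      using N(1) by (intro mult_left_mono) auto
    also have "\<dots> = (\<Sum>j\<in>{k}. (1 / 2) ^ j * G j (H (m k)))"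
      by simp
    also have "\<dots> \<le> \<phi> (H (m k))"
      unfolding \<phi>_def using sm[OF H(1)] H(2)
      by (intro sum_le_suminf) (auto simp: G_def g_def intro!: mult_nonneg_nonneg integral_nonneg)
    also have "\<dots> \<le> M" using M[of "m k"] by simp
    finally show ?thesis
      by (simp add: power_mult_distrib[symmetric])
  qed
  then show False
    using real_arch_pow[of 2 M] by (meson not_le one_less_numeral_iff semiring_norm(76))
qed

text \<open>A perturbation that is small relative to a weakly convergent nonnegative sequence vanishes weakly.
  For \<open>p = \<infinity>\<close> the functional given by \<open>g\<close> is tested with \<open>\<bar>g\<bar>\<close>, and the pairings of \<open>H n\<close>
  with \<open>\<bar>g\<bar>\<close> are bounded because they converge; for finite \<open>p\<close> the sequence \<open>H n\<close> is
  bounded in norm by the previous lemma.\<close>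

lemma functional_dominated_tendsto_zero:
  assumes p: "1 \<le> p"
    and H: "Lp_weak_lim p H h" "\<And>n u. 0 \<le> H n u"
    and E: "\<And>n. E n \<in> Lp p"
    and dom: "\<And>\<epsilon>. 0 < \<epsilon> \<Longrightarrow> \<forall>\<^sub>F n in sequentially. AE u in lborel. \<bar>E n u\<bar> \<le> \<epsilon> * H n u"
    and \<phi>: "\<phi> \<in> Lp_functionals p"
  shows "(\<lambda>n. \<phi> (E n)) \<longlonglongrightarrow> 0"
proof -
  have HLp: "H n \<in> Lp p" for n
    using H by (simp add: Lp_weak_lim_def)
  have Hlim: "(\<lambda>n. \<psi> (H n)) \<longlonglongrightarrow> \<psi> h" if "\<psi> \<in> Lp_functionals p" for \<psi>
    using H that by (simp add: Lp_weak_lim_def)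
  note [measurable] = HLp[THEN Lp_measurable] E[THEN Lp_measurable]
  have bound: "\<exists>B. \<forall>n \<epsilon>. 0 < \<epsilon> \<longrightarrow> (AE u in lborel. \<bar>E n u\<bar> \<le> \<epsilon> * H n u) \<longrightarrow> \<bar>\<phi> (E n)\<bar> \<le> \<epsilon> * B"
  proof (cases "p = \<infinity>")
    case True
    then obtain g where g: "g \<in> Lp 1" "\<And>h. h \<in> Lp p \<Longrightarrow> \<phi> h = (\<integral>u. h u * g u \<partial>lborel)"
      using \<phi> by (auto simp: Lp_functionals_def)
    note [measurable] = Lp_measurable[OF g(1)]
    have gi: "integrable lborel (\<lambda>u. \<bar>g u\<bar>)"
      using g(1) by (simp add: Lp_def)
    have ga: "(\<lambda>u. \<bar>g u\<bar>) \<in> Lp 1"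
      using g(1) by (simp add: Lp_def)
    then have \<psi>: "(\<lambda>h. \<integral>u. h u * \<bar>g u\<bar> \<partial>lborel) \<in> Lp_functionals p"
      using True by (auto simp: Lp_functionals_def)
    obtain B where B: "\<And>n. \<bar>\<integral>u. H n u * \<bar>g u\<bar> \<partial>lborel\<bar> \<le> B"
      using convergent_imp_Bseq[OF convergentI[OF Hlim[OF \<psi>]]] unfolding Bseq_def by auto
    have "\<bar>\<phi> (E n)\<bar> \<le> \<epsilon> * B" if e: "0 < \<epsilon>" "AE u in lborel. \<bar>E n u\<bar> \<le> \<epsilon> * H n u" for n \<epsilon>
    proof -
      obtain C where C: "AE u in lborel. \<bar>H n u\<bar> \<le> C"
        using HLp True by (auto simp: Lp_def)
      have int: "integrable lborel (\<lambda>u. H n u * \<bar>g u\<bar>)"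
      proof (rule Bochner_Integration.integrable_bound)
        show "integrable lborel (\<lambda>u. C * \<bar>g u\<bar>)"
          using gi by simp
        show "AE u in lborel. norm (H n u * \<bar>g u\<bar>) \<le> norm (C * \<bar>g u\<bar>)"
          using C by eventually_elim (auto simp: abs_mult intro!: mult_right_mono)
      qed measurable
      have dom: "AE u in lborel. norm (E n u * g u) \<le> \<epsilon> * (H n u * \<bar>g u\<bar>)"
        using e(2) by eventually_elim (simp add: abs_mult mult.assoc[symmetric] mult_right_mono)
      have "\<bar>\<phi> (E n)\<bar> \<le> (\<integral>u. \<epsilon> * (H n u * \<bar>g u\<bar>) \<partial>lborel)"
      proof -
        have Eg: "integrable lborel (\<lambda>u. E n u * g u)"
        proof (rule Bochner_Integration.integrable_bound)
          show "integrable lborel (\<lambda>u. \<epsilon> * (H n u * \<bar>g u\<bar>))"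
            using int by simp
          show "AE u in lborel. norm (E n u * g u) \<le> norm (\<epsilon> * (H n u * \<bar>g u\<bar>))"
            using dom by eventually_elim simp
        qed measurable
        have "\<bar>\<phi> (E n)\<bar> \<le> (\<integral>u. \<bar>E n u * g u\<bar> \<partial>lborel)"
          using g(2)[OF E] by simp
        also have "\<dots> \<le> (\<integral>u. \<epsilon> * (H n u * \<bar>g u\<bar>) \<partial>lborel)"
          using Eg int dom by (intro integral_mono_AE) auto
        finally show ?thesis .
      qed
      also have "\<dots> \<le> \<epsilon> * B"
        using B[of n] e by (auto intro!: mult_left_mono)
      finally show ?thesis .
    qed
    then show ?thesis by blast
  next
    case False
    let ?r = "enn2real p"
    have r: "1 \<le> ?r" using one_le_enn2real p False by blast
    obtain C where C: "0 \<le> C" "\<And>h. h \<in> Lp p \<Longrightarrow>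
        \<bar>\<phi> h\<bar> \<le> C * (\<integral>u. \<bar>h u\<bar> powr ?r \<partial>lborel) powr (1 / ?r)"
      using \<phi> by (auto simp: finite_functional_iff[OF False])
    have "\<And>\<phi>. \<phi> \<in> Lp_functionals p \<Longrightarrow> Bseq (\<lambda>n. \<phi> (H n))"
      using Hlim by (meson convergentI convergent_imp_Bseq)
    then obtain B where B: "\<And>n. (\<integral>u. \<bar>H n u\<bar> powr ?r \<partial>lborel) \<le> B"
      using weakly_bounded_imp_norm_bounded[OF p False, of H] HLp H(2) by blast
    have "\<bar>\<phi> (E n)\<bar> \<le> \<epsilon> * (C * B powr (1 / ?r))"
      if e: "0 < \<epsilon>" "AE u in lborel. \<bar>E n u\<bar> \<le> \<epsilon> * H n u" for n \<epsilon>
    proof -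
      have "(\<integral>u. \<bar>E n u\<bar> powr ?r \<partial>lborel) \<le> (\<integral>u. \<epsilon> powr ?r * \<bar>H n u\<bar> powr ?r \<partial>lborel)"
      proof (rule integral_mono_AE)
        show "AE u in lborel. \<bar>E n u\<bar> powr ?r \<le> \<epsilon> powr ?r * \<bar>H n u\<bar> powr ?r"
          using e(2)
        proof eventually_elim
          case (elim u)
          then have "\<bar>E n u\<bar> powr ?r \<le> (\<epsilon> * H n u) powr ?r"
            by (intro powr_mono2) auto
          then show ?case using e(1) H(2) by (simp add: powr_mult)
        qed
      qed (use E HLp False in \<open>auto simp: Lp_finite_iff\<close>)
      also have "\<dots> \<le> \<epsilon> powr ?r * B"
        using B[of n] by (auto intro!: mult_left_mono)
      finally have "(\<integral>u. \<bar>E n u\<bar> powr ?r \<partial>lborel) powr (1 / ?r) \<le> (\<epsilon> powr ?r * B) powr (1 / ?r)"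
        using r by (intro powr_mono2) auto
      also have "\<dots> = \<epsilon> * B powr (1 / ?r)"
        using e r by (simp add: powr_mult powr_powr)
      finally have "C * (\<integral>u. \<bar>E n u\<bar> powr ?r \<partial>lborel) powr (1 / ?r) \<le> C * (\<epsilon> * B powr (1 / ?r))"
        using C(1) by (rule mult_left_mono)
      with C(2)[OF E[of n]] show ?thesis by (simp add: mult_ac)
    qed
    then show ?thesis by blast
  qed
  then obtain B where B: "\<And>n \<epsilon>. 0 < \<epsilon> \<Longrightarrow> (AE u in lborel. \<bar>E n u\<bar> \<le> \<epsilon> * H n u)
      \<Longrightarrow> \<bar>\<phi> (E n)\<bar> \<le> \<epsilon> * B" by blast
  show ?thesis
  proof (rule LIMSEQ_I)
    fix e :: real assume e: "0 < e"
    define \<epsilon> where "\<epsilon> = e / (\<bar>B\<bar> + 1)"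
    have \<epsilon>: "0 < \<epsilon>" using e by (simp add: \<epsilon>_def)
    have "\<epsilon> * B < e"
    proof -
      have "\<epsilon> * B < \<epsilon> * (\<bar>B\<bar> + 1)" using \<epsilon> by (intro mult_strict_left_mono) auto
      then show ?thesis by (simp add: \<epsilon>_def)
    qed
    with dom[OF \<epsilon>] show "\<exists>no. \<forall>n\<ge>no. norm (\<phi> (E n) - 0) < e"
      unfolding eventually_sequentially using B[OF \<epsilon>] by fastforce
  qed
qed

text \<open>The difference \<open>d\<close> of two limits is tested with its own sign on bounded intervals. The
  truncation puts the test function in every dual space.\<close>

lemma Lp_weak_lim_unique:
  assumes p: "1 \<le> p" and lim: "Lp_weak_lim p H h" "Lp_weak_lim p H k"
  shows "AE u in lborel. h u = k u"
proof -
  have hk: "h \<in> Lp p" "k \<in> Lp p"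
    using lim by (auto simp: Lp_weak_lim_def)
  define d where "d u = 1 * h u + (-1) * k u" for u
  have dLp: "d \<in> Lp p"
    using Lp_lincomb[OF p hk, of 1 "-1"] by (simp add: d_def[abs_def])
  note [measurable] = Lp_measurable[OF dLp]
  have "AE u in lborel. u \<in> {- real m..real m} \<longrightarrow> d u = 0" for m :: nat
  proof -
    define k1 :: "real \<Rightarrow> real" where "k1 = indicator {- real m..real m}"
    define g where "g u = sgn (d u) * k1 u" for u
    have [measurable]: "k1 \<in> borel_measurable borel" "g \<in> borel_measurable borel"
      unfolding k1_def g_def by measurable
    have k1i: "integrable lborel k1"
      unfolding k1_def by simp
    \<comment> \<open>an indicator equals each of its powers, also the zeroth, as \<open>0 powr 0 = 0\<close>\<close>
    have gk: "\<bar>g u\<bar> \<le> k1 u powr c" for u c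
      by (auto simp: g_def k1_def indicator_def abs_sgn_eq)
    have di: "integrable lborel (\<lambda>u. d u * g u)" "(\<lambda>h. \<integral>u. h u * g u \<partial>lborel) \<in> Lp_functionals p"
    proof -
      show "(\<lambda>h. \<integral>u. h u * g u \<partial>lborel) \<in> Lp_functionals p"
      proof (cases "p = \<infinity>")
        case True
        have "integrable lborel g"
          using k1i by (rule Bochner_Integration.integrable_bound) (use gk[of _ 1] in auto)
        then show ?thesis
          using True by (auto simp: Lp_functionals_def Lp_def intro!: exI[of _ g])
      next
        case False
        have "\<bar>k1 u\<bar> powr enn2real p = k1 u" for u
          by (simp add: k1_def indicator_def)
        then have "k1 \<in> Lp p"
          using False k1i by (simp add: Lp_finite_iff)
        then show ?thesis
          using p False gk by (intro integral_functional[where k = k1]) (auto simp: k1_def)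
      qed
      show "integrable lborel (\<lambda>u. d u * g u)"
      proof (cases "p = \<infinity>")
        case True
        then obtain C where C: "AE u in lborel. \<bar>d u\<bar> \<le> C"
          using dLp by (auto simp: Lp_def)
        show ?thesis
        proof (rule Bochner_Integration.integrable_bound)
          show "integrable lborel (\<lambda>u. C * k1 u)"
            using k1i by simp
          show "AE u in lborel. norm (d u * g u) \<le> norm (C * k1 u)"
            using C by eventually_elim (auto simp: g_def k1_def indicator_def abs_mult abs_sgn_eq)
        qed measurable
      next
        case False
        have "k1 u powr enn2real p = k1 u" for u
          by (simp add: k1_def indicator_def)
        then show ?thesis
          using p False gk dLp one_le_enn2real k1i
          by (intro integrable_mult_powr[where k = k1 and r = "enn2real p"])
            (auto simp: k1_def Lp_finite_iff)
      qed
    qed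
    have "(\<integral>u. h u * g u \<partial>lborel) = (\<integral>u. k u * g u \<partial>lborel)"
      using lim di(2) LIMSEQ_unique unfolding Lp_weak_lim_def by blast
    then have "(\<integral>u. d u * g u \<partial>lborel) = 0"
      using functional_lincomb[OF di(2) p hk, of 1 "-1"] by (simp add: d_def)
    moreover have dg: "d u * g u = \<bar>d u\<bar> * k1 u" for u
      by (simp add: g_def mult.assoc[symmetric] mult_sgn_abs linordered_idom_class.abs_sgn)
    ultimately have "AE u in lborel. \<bar>d u\<bar> * k1 u = 0"
      using integral_nonneg_eq_0_iff_AE[OF di(1)] by (simp add: k1_def)
    then show ?thesis
      by eventually_elim (auto simp: k1_def)
  qed
  then have "AE u in lborel. \<forall>m::nat. u \<in> {- real m..real m} \<longrightarrow> d u = 0"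
    unfolding AE_all_countable by blast
  then show ?thesis
  proof eventually_elim
    case (elim u)
    obtain m :: nat where "\<bar>u\<bar> \<le> real m"
      using real_arch_simple by blast
    with elim[rule_format, of m] have "d u = 0" by (simp add: abs_le_iff)
    then show ?case by (simp add: d_def)
  qed
qed

section \<open>Transport along a strictly monotone C1 function\<close>

text \<open>The derivative \<open>D\<close> may vanish, even on a set of positive measure, so the inverse of \<open>f\<close>
  need not be differentiable. For this reason the change of variables below expresses integrals over
  the image of \<open>f\<close> by integrals over its domain.\<close>

locale C1_strictly_monotone =
  fixes f D :: "real \<Rightarrow> real"
  assumes deriv: "(f has_real_derivative D u) (at u)"
    and cont_deriv: "continuous_on UNIV D"
    and monotone: "strict_mono f \<or> strict_antimono_on UNIV f"
begin

lemma inj: "inj f"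
  using monotone
proof
  assume "strict_mono f"
  then show ?thesis by (simp add: strict_mono_eq inj_def)
next
  assume "strict_antimono_on UNIV f"
  then have "f v < f u" if "u < v" for u v
    using that by (simp add: monotone_on_def)
  then show ?thesis
    by (metis injI linorder_less_linear order_less_irrefl)
qed

lemma cont: "continuous_on A f"
  using deriv by (meson DERIV_isCont continuous_at_imp_continuous_on)

lemma f_measurable [measurable]: "f \<in> borel_measurable borel"
  using cont by (rule borel_measurable_continuous_onI)

lemma D_measurable [measurable]: "D \<in> borel_measurable borel"
  using cont_deriv by (rule borel_measurable_continuous_onI)

lemma image_measurable [measurable]: "f ` {a..b} \<in> sets borel"
  using compact_continuous_image[OF cont compact_Icc] by (intro borel_closed compact_imp_closed)

text \<open>Stated for a function that is not the one of the locale, because the decreasing case applies it to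
  \<open>-f\<close>.\<close>

lemma nn_integral_image_increasing:
  fixes F :: "real \<Rightarrow> real"
  assumes g: "\<And>u. (g has_real_derivative g' u) (at u)" "continuous_on UNIV g'" "strict_mono g"
    and F [measurable]: "F \<in> borel_measurable borel" and "a \<le> b"
  shows "(\<integral>\<^sup>+v. ennreal (F v * indicator (g ` {a..b}) v) \<partial>lborel)
    = (\<integral>\<^sup>+u. ennreal (F (g u) * \<bar>g' u\<bar> * indicator {a..b} u) \<partial>lborel)"
proof -
  have nn: "0 \<le> g' u" for u
    using mono_on_imp_deriv_nonneg[of UNIV g "g' u" u] g(1,3)
    by (auto simp: strict_mono_mono mono_imp_mono_on)
  have "continuous_on {a..b} g"
    using g(1) by (meson DERIV_isCont continuous_at_imp_continuous_on)
  then have im: "g ` {a..b} = {g a..g b}"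
  proof (intro subset_antisym subsetI)
    fix v assume "v \<in> {g a..g b}"
    then show "v \<in> g ` {a..b}"
      using IVT'[of g a v b] \<open>continuous_on {a..b} g\<close> \<open>a \<le> b\<close> by force
  qed (use g(3) in \<open>auto simp: strict_mono_less_eq\<close>)
  show ?thesis
    unfolding im
    using nn_integral_substitution[of g a b F g'] g nn \<open>a \<le> b\<close>
    by (auto simp: set_borel_measurable_def continuous_on_subset)
qed

lemma nn_integral_image:
  fixes F :: "real \<Rightarrow> real"
  assumes [measurable]: "F \<in> borel_measurable borel" and ab: "a \<le> b"
  shows "(\<integral>\<^sup>+v. ennreal (F v * indicator (f ` {a..b}) v) \<partial>lborel)
    = (\<integral>\<^sup>+u. ennreal (F (f u) * \<bar>D u\<bar> * indicator {a..b} u) \<partial>lborel)"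
  using monotone
proof
  assume "strict_mono f"
  then show ?thesis
    using nn_integral_image_increasing[OF deriv cont_deriv] ab by simp
next
  assume anti: "strict_antimono_on UNIV f"
  define g where "g u = - f u" for u
  have g: "(g has_real_derivative - D u) (at u)" for u
    unfolding g_def[abs_def] by (intro DERIV_minus deriv)
  have "strict_mono g"
    using anti by (auto simp: g_def strict_mono_def monotone_on_def)
  then have "(\<integral>\<^sup>+v. ennreal (F (- v) * indicator (g ` {a..b}) v) \<partial>lborel)
    = (\<integral>\<^sup>+u. ennreal (F (- g u) * \<bar>- D u\<bar> * indicator {a..b} u) \<partial>lborel)"
    using ab by (intro nn_integral_image_increasing g continuous_on_minus cont_deriv) auto
  moreover have "(\<integral>\<^sup>+v. ennreal (F v * indicator (f ` {a..b}) v) \<partial>lborel)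
    = (\<integral>\<^sup>+v. ennreal (F (- v) * indicator (f ` {a..b}) (- v)) \<partial>lborel)"
    by (subst nn_integral_real_affine[where c = "-1" and t = 0]) auto
  moreover have "indicator (f ` {a..b}) (- v) = (indicator (g ` {a..b}) v :: real)" for v
    by (force simp: g_def indicator_def)
  ultimately show ?thesis
    by (simp add: g_def)
qed

text \<open>The change of variables formula as an identity of measures: it then transfers integrability,
  integrals and almost everywhere statements alike.\<close>

lemma lborel_image_eq_distr:
  assumes "a \<le> b"
  shows "density lborel (\<lambda>v. ennreal (indicator (f ` {a..b}) v))
    = distr (density lborel (\<lambda>u. ennreal (\<bar>D u\<bar> * indicator {a..b} u))) borel f"
    (is "?M = ?N")
proof (rule measure_eqI)
  fix A assume "A \<in> sets ?M"
  then have [measurable]: "A \<in> sets borel" by simp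
  have "emeasure ?M A = (\<integral>\<^sup>+v. ennreal (indicator A v * indicator (f ` {a..b}) v) \<partial>lborel)"
    by (subst emeasure_density) (auto intro!: nn_integral_cong simp: indicator_def)
  also have "\<dots> = (\<integral>\<^sup>+u. ennreal (indicator A (f u) * \<bar>D u\<bar> * indicator {a..b} u) \<partial>lborel)"
    using assms by (rule nn_integral_image[rotated]) simp
  also have "\<dots> = emeasure ?N A"
    using measurable_sets[OF f_measurable \<open>A \<in> sets borel\<close>]
    by (subst emeasure_distr, simp, simp, subst emeasure_density)
      (auto intro!: nn_integral_cong simp: indicator_def)
  finally show "emeasure ?M A = emeasure ?N A" .
qed simp

lemma
  fixes Q :: "real \<Rightarrow> real"
  assumes ab: "a \<le> b" and [measurable]: "Q \<in> borel_measurable borel"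
  shows integrable_image: "integrable lborel (\<lambda>v. indicator (f ` {a..b}) v * Q v) \<longleftrightarrow>
      integrable lborel (\<lambda>u. \<bar>D u\<bar> * indicator {a..b} u * Q (f u))"
    and integral_image: "(\<integral>v. indicator (f ` {a..b}) v * Q v \<partial>lborel)
      = (\<integral>u. \<bar>D u\<bar> * indicator {a..b} u * Q (f u) \<partial>lborel)"
proof -
  let ?M = "density lborel (\<lambda>v. ennreal (indicator (f ` {a..b}) v))"
  let ?N = "density lborel (\<lambda>u. ennreal (\<bar>D u\<bar> * indicator {a..b} u))"
  have "integrable lborel (\<lambda>v. indicator (f ` {a..b}) v * Q v) \<longleftrightarrow> integrable ?M Q"
    by (subst integrable_real_density) auto
  also have "\<dots> \<longleftrightarrow> integrable ?N (\<lambda>u. Q (f u))"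
    unfolding lborel_image_eq_distr[OF ab] by (subst integrable_distr_eq) auto
  also have "\<dots> \<longleftrightarrow> integrable lborel (\<lambda>u. \<bar>D u\<bar> * indicator {a..b} u * Q (f u))"
    by (subst integrable_real_density) auto
  finally show "integrable lborel (\<lambda>v. indicator (f ` {a..b}) v * Q v) \<longleftrightarrow>
      integrable lborel (\<lambda>u. \<bar>D u\<bar> * indicator {a..b} u * Q (f u))" .
  have "(\<integral>v. indicator (f ` {a..b}) v * Q v \<partial>lborel) = (\<integral>v. Q v \<partial>?M)"
    by (subst integral_real_density) auto
  also have "\<dots> = (\<integral>u. Q (f u) \<partial>?N)"
    unfolding lborel_image_eq_distr[OF ab] by (subst integral_distr) auto
  also have "\<dots> = (\<integral>u. \<bar>D u\<bar> * indicator {a..b} u * Q (f u) \<partial>lborel)"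
    by (subst integral_real_density) auto
  finally show "(\<integral>v. indicator (f ` {a..b}) v * Q v \<partial>lborel)
      = (\<integral>u. \<bar>D u\<bar> * indicator {a..b} u * Q (f u) \<partial>lborel)" .
qed

lemma AE_image:
  assumes ab: "a \<le> b" and [measurable]: "Measurable.pred borel P"
    and P: "AE u in lborel. u \<in> {a..b} \<longrightarrow> P (f u)"
  shows "AE v in lborel. v \<in> f ` {a..b} \<longrightarrow> P v"
proof -
  have "AE u in density lborel (\<lambda>u. ennreal (\<bar>D u\<bar> * indicator {a..b} u)). P (f u)"
    using P by (auto simp: AE_density indicator_def)
  then have "AE v in density lborel (\<lambda>v. ennreal (indicator (f ` {a..b}) v)). P v"
    unfolding lborel_image_eq_distr[OF ab] by (simp add: AE_distr_iff)
  then show ?thesis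
    by (simp add: AE_density indicator_def)
qed

text \<open>The transport of \<open>w * h\<close> along \<open>f\<close>, cut off to \<open>[-c, c]\<close>. On the whole line, in general, neither the
  weight \<open>\<bar>D\<bar>\<close> nor the density \<open>\<bar>D\<bar>\<close> of the change of variables is bounded, so the cut-off
  is what makes the operator bounded on \<open>L^p\<close>; it is harmless for functions that live on the range
  of a path up to a fixed time.\<close>

definition pushforward :: "(real \<Rightarrow> real) \<Rightarrow> real \<Rightarrow> (real \<Rightarrow> real) \<Rightarrow> real \<Rightarrow> real" where
  "pushforward w c h v = (if v \<in> f ` {- c..c} then w (inv f v) * h (inv f v) else 0)"

lemma pushforward_apply: "pushforward w c h (f u) = indicator {- c..c} u * (w u * h u)"
  using inj by (auto simp: pushforward_def indicator_def inj_image_mem_iff)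

lemma pushforward_outside: "v \<notin> f ` {- c..c} \<Longrightarrow> pushforward w c h v = 0"
  by (simp add: pushforward_def)

lemma pushforward_lincomb:
  "pushforward w c (\<lambda>u. a * h u + b * k u)
    = (\<lambda>v. a * pushforward w c h v + b * pushforward w c k v)"
  by (rule ext) (simp add: pushforward_def algebra_simps)

context
  fixes w :: "real \<Rightarrow> real" and c :: real
  assumes c: "0 \<le> c" and w: "continuous_on UNIV w"
begin

private lemma w_measurable [measurable]: "w \<in> borel_measurable borel"
  using w by (rule borel_measurable_continuous_onI)

private lemma pushforward_measurable [measurable]:
  assumes [measurable]: "h \<in> borel_measurable borel"
  shows "pushforward w c h \<in> borel_measurable borel"
proof -
  \<comment> \<open>the inverse is continuous on the compact image, hence this extension of it is Borel\<close>
  define G where "G v = (if v \<in> f ` {- c..c} then inv f v else 0)" for v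
  have "continuous_on (f ` {- c..c}) (inv f)"
    using inj by (intro continuous_on_inv cont) (auto simp: inv_f_f)
  then have [measurable]: "G \<in> borel_measurable borel"
    unfolding G_def[abs_def] by (intro borel_measurable_continuous_on_if) auto
  have "pushforward w c h = (\<lambda>v. if v \<in> f ` {- c..c} then w (G v) * h (G v) else 0)"
    by (auto simp: pushforward_def G_def)
  then show ?thesis by simp
qed

text \<open>One constant serves for all \<open>h\<close>, so that the adjoint of the transport preserves norm bounds.\<close>

lemma pushforward_norm_bound:
  assumes r: "1 \<le> r"
  shows "\<exists>M\<ge>0. \<forall>h. h \<in> borel_measurable borel \<longrightarrow> integrable lborel (\<lambda>u. \<bar>h u\<bar> powr r) \<longrightarrow>
    integrable lborel (\<lambda>v. \<bar>pushforward w c h v\<bar> powr r) \<and>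
    (\<integral>v. \<bar>pushforward w c h v\<bar> powr r \<partial>lborel) \<le> M * (\<integral>u. \<bar>h u\<bar> powr r \<partial>lborel)"
proof -
  obtain W where W: "0 \<le> W" "\<And>u. u \<in> {- c..c} \<Longrightarrow> \<bar>w u\<bar> \<le> W"
    using continuous_on_Icc_bounded[OF continuous_on_subset[OF w subset_UNIV]] by blast
  obtain B where B: "0 \<le> B" "\<And>u. u \<in> {- c..c} \<Longrightarrow> \<bar>D u\<bar> \<le> B"
    using continuous_on_Icc_bounded[OF continuous_on_subset[OF cont_deriv subset_UNIV]] by blast
  have "integrable lborel (\<lambda>v. \<bar>pushforward w c h v\<bar> powr r) \<and>
    (\<integral>v. \<bar>pushforward w c h v\<bar> powr r \<partial>lborel) \<le> (B * W powr r) * (\<integral>u. \<bar>h u\<bar> powr r \<partial>lborel)"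
    if [measurable]: "h \<in> borel_measurable borel" and h: "integrable lborel (\<lambda>u. \<bar>h u\<bar> powr r)" for h
  proof -
    let ?Q = "\<lambda>v. \<bar>pushforward w c h v\<bar> powr r"
    have Q: "indicator (f ` {- c..c}) v * ?Q v = ?Q v" for v
      using pushforward_outside by (auto simp: indicator_def)
    have le: "\<bar>D u\<bar> * indicator {- c..c} u * ?Q (f u) \<le> (B * W powr r) * \<bar>h u\<bar> powr r" for u
    proof (cases "u \<in> {- c..c}")
      case True
      then have "\<bar>D u\<bar> * (\<bar>w u\<bar> powr r * \<bar>h u\<bar> powr r) \<le> B * (W powr r * \<bar>h u\<bar> powr r)"
        using W B r by (intro mult_mono powr_mono2) auto
      then show ?thesis
        using True by (simp add: pushforward_apply abs_mult powr_mult mult.assoc)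
    qed (use B W in auto)
    have int: "integrable lborel (\<lambda>u. \<bar>D u\<bar> * indicator {- c..c} u * ?Q (f u))"
    proof (rule Bochner_Integration.integrable_bound)
      show "integrable lborel (\<lambda>u. (B * W powr r) * \<bar>h u\<bar> powr r)"
        using h by simp
      show "AE u in lborel. norm (\<bar>D u\<bar> * indicator {- c..c} u * ?Q (f u))
          \<le> norm ((B * W powr r) * \<bar>h u\<bar> powr r)"
        using le B W by (intro AE_I2) (simp add: abs_mult)
    qed measurable
    have "integrable lborel ?Q"
      using int integrable_image[of "- c" c ?Q] c unfolding Q by simp
    moreover have "(\<integral>v. ?Q v \<partial>lborel) = (\<integral>u. \<bar>D u\<bar> * indicator {- c..c} u * ?Q (f u) \<partial>lborel)"
      using integral_image[of "- c" c ?Q] c unfolding Q by simp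
    moreover have "\<dots> \<le> (\<integral>u. (B * W powr r) * \<bar>h u\<bar> powr r \<partial>lborel)"
      using int h le by (intro integral_mono) auto
    ultimately show ?thesis by simp
  qed
  then show ?thesis
    using B(1) by (intro exI[of _ "B * W powr r"]) auto
qed

lemma pushforward_Lp:
  assumes p: "1 \<le> p" and h: "h \<in> Lp p"
  shows "pushforward w c h \<in> Lp p"
proof (cases "p = \<infinity>")
  case True
  note [measurable] = Lp_measurable[OF h]
  obtain W where W: "0 \<le> W" "\<And>u. u \<in> {- c..c} \<Longrightarrow> \<bar>w u\<bar> \<le> W"
    using continuous_on_Icc_bounded[OF continuous_on_subset[OF w subset_UNIV]] by blast
  obtain C where C: "AE u in lborel. \<bar>h u\<bar> \<le> C"
    using h True by (auto simp: Lp_def)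
  have "AE v in lborel. v \<in> f ` {- c..c} \<longrightarrow> \<bar>pushforward w c h v\<bar> \<le> W * \<bar>C\<bar>"
  proof (rule AE_image)
    show "AE u in lborel. u \<in> {- c..c} \<longrightarrow> \<bar>pushforward w c h (f u)\<bar> \<le> W * \<bar>C\<bar>"
      using C
      by eventually_elim (use W in \<open>auto simp: pushforward_apply abs_mult intro!: mult_mono\<close>)
  qed (use c in auto)
  then have "AE v in lborel. \<bar>pushforward w c h v\<bar> \<le> W * \<bar>C\<bar>"
    by eventually_elim (use W in \<open>auto simp: pushforward_def\<close>)
  then show ?thesis
    using True by (auto simp: Lp_def)
next
  case False
  then show ?thesis
    using pushforward_norm_bound[OF one_le_enn2real[OF p False]] h pushforward_measurable
    by (auto simp: Lp_finite_iff)
qed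

text \<open>The adjoint of the transport maps functionals to functionals, so the transport is weakly
  continuous. For finite \<open>p\<close> this is the norm bound; for \<open>p = \<infinity>\<close> the adjoint is computed by the
  change of variables as \<open>g \<mapsto> \<bar>D\<bar> * w * (g \<circ> f)\<close> on \<open>[-c, c]\<close>, which maps \<open>L^1\<close> to itself.\<close>

lemma pushforward_functional:
  assumes p: "1 \<le> p" and \<phi>: "\<phi> \<in> Lp_functionals p"
  shows "(\<lambda>h. \<phi> (pushforward w c h)) \<in> Lp_functionals p"
proof (cases "p = \<infinity>")
  case True
  then obtain g where g: "g \<in> Lp 1" "\<And>h. h \<in> Lp p \<Longrightarrow> \<phi> h = (\<integral>u. h u * g u \<partial>lborel)"
    using \<phi> by (auto simp: Lp_functionals_def)
  note [measurable] = Lp_measurable[OF g(1)]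
  obtain W where W: "0 \<le> W" "\<And>u. u \<in> {- c..c} \<Longrightarrow> \<bar>w u\<bar> \<le> W"
    using continuous_on_Icc_bounded[OF continuous_on_subset[OF w subset_UNIV]] by blast
  define g' where "g' u = \<bar>D u\<bar> * indicator {- c..c} u * w u * g (f u)" for u
  have "integrable lborel (\<lambda>v. indicator (f ` {- c..c}) v * \<bar>g v\<bar>)"
  proof (rule Bochner_Integration.integrable_bound)
    show "integrable lborel (\<lambda>u. \<bar>g u\<bar>)"
      using g(1) by (simp add: Lp_def)
  qed (auto simp: indicator_def)
  then have gf: "integrable lborel (\<lambda>u. \<bar>D u\<bar> * indicator {- c..c} u * \<bar>g (f u)\<bar>)"
    using integrable_image[of "- c" c "\<lambda>v. \<bar>g v\<bar>"] c by simp
  have "integrable lborel g'"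
  proof (rule Bochner_Integration.integrable_bound)
    show "integrable lborel (\<lambda>u. W * (\<bar>D u\<bar> * indicator {- c..c} u * \<bar>g (f u)\<bar>))"
      using gf by simp
    show "AE u in lborel. norm (g' u) \<le> norm (W * (\<bar>D u\<bar> * indicator {- c..c} u * \<bar>g (f u)\<bar>))"
    proof (intro AE_I2)
      fix u
      show "norm (g' u) \<le> norm (W * (\<bar>D u\<bar> * indicator {- c..c} u * \<bar>g (f u)\<bar>))"
      proof (cases "u \<in> {- c..c}")
        case True
        then have "\<bar>w u\<bar> * (\<bar>D u\<bar> * \<bar>g (f u)\<bar>) \<le> W * (\<bar>D u\<bar> * \<bar>g (f u)\<bar>)"
          using W by (intro mult_right_mono) auto
        then show ?thesis
          using True W by (simp add: g'_def abs_mult mult_ac)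
      qed (auto simp: g'_def)
    qed
  qed (simp add: g'_def[abs_def])
  then have "g' \<in> Lp 1"
    by (auto simp: Lp_def)
  moreover have "\<phi> (pushforward w c h) = (\<integral>u. h u * g' u \<partial>lborel)" if h: "h \<in> Lp p" for h
  proof -
    note [measurable] = Lp_measurable[OF h]
    have "\<phi> (pushforward w c h) = (\<integral>v. pushforward w c h v * g v \<partial>lborel)"
      using g(2) pushforward_Lp[OF p h] by simp
    also have "\<dots> = (\<integral>v. indicator (f ` {- c..c}) v * (pushforward w c h v * g v) \<partial>lborel)"
      by (intro Bochner_Integration.integral_cong) (auto simp: pushforward_outside indicator_def)
    also have "\<dots> = (\<integral>u. \<bar>D u\<bar> * indicator {- c..c} u * (pushforward w c h (f u) * g (f u)) \<partial>lborel)"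
      using c by (intro integral_image) auto
    also have "\<dots> = (\<integral>u. h u * g' u \<partial>lborel)"
      by (intro Bochner_Integration.integral_cong)
        (auto simp: pushforward_apply g'_def indicator_def)
    finally show ?thesis .
  qed
  ultimately show ?thesis
    using True by (auto simp: Lp_functionals_def)
next
  case False
  let ?r = "enn2real p"
  have r: "1 \<le> ?r" using one_le_enn2real p False by blast
  obtain C where C: "0 \<le> C" "\<And>h. h \<in> Lp p \<Longrightarrow>
      \<bar>\<phi> h\<bar> \<le> C * (\<integral>u. \<bar>h u\<bar> powr ?r \<partial>lborel) powr (1 / ?r)"
    using \<phi> by (auto simp: finite_functional_iff[OF False])
  obtain M where M: "0 \<le> M" "\<And>h. h \<in> Lp p \<Longrightarrow>
      (\<integral>v. \<bar>pushforward w c h v\<bar> powr ?r \<partial>lborel) \<le> M * (\<integral>u. \<bar>h u\<bar> powr ?r \<partial>lborel)"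
    using pushforward_norm_bound[OF r] by (auto simp: Lp_finite_iff[OF False])
  have "\<bar>\<phi> (pushforward w c h)\<bar> \<le> (C * M powr (1 / ?r)) * (\<integral>u. \<bar>h u\<bar> powr ?r \<partial>lborel) powr (1 / ?r)"
    if h: "h \<in> Lp p" for h
  proof -
    have "\<bar>\<phi> (pushforward w c h)\<bar> \<le> C * (\<integral>v. \<bar>pushforward w c h v\<bar> powr ?r \<partial>lborel) powr (1 / ?r)"
      using C(2) pushforward_Lp[OF p h] by blast
    also have "\<dots> \<le> C * (M * (\<integral>u. \<bar>h u\<bar> powr ?r \<partial>lborel)) powr (1 / ?r)"
      using C(1) M(2)[OF h] r by (intro mult_left_mono powr_mono2) auto
    finally show ?thesis
      by (simp add: powr_mult mult.assoc)
  qed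
  moreover have "\<phi> (pushforward w c (\<lambda>u. a * h u + b * k u))
      = a * \<phi> (pushforward w c h) + b * \<phi> (pushforward w c k)" if "h \<in> Lp p" "k \<in> Lp p" for h k a b
    unfolding pushforward_lincomb using that pushforward_Lp[OF p] functional_lincomb[OF \<phi> p] by blast
  ultimately show ?thesis
    using C(1) unfolding finite_functional_iff[OF False]
    by (intro conjI exI[of _ "C * M powr (1 / ?r)"]) auto
qed

end

end

section \<open>Discrete local times and oscillation\<close>

lemma stopped_in: "0 \<le> t \<Longrightarrow> stopped \<pi> t j \<in> {0..t}"
  unfolding stopped_def
  by (auto simp: enn2real_nonneg intro!: enn2real_leI)

lemma stopped_ennreal: "0 \<le> t \<Longrightarrow> ennreal (stopped \<pi> t j) = min (\<pi> j) (ennreal t)"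
  unfolding stopped_def by (intro ennreal_enn2real) (simp add: min_less_iff_disj)

lemma half_open_self [simp]: "half_open a a = {}"
  by (simp add: half_open_def)

lemma half_open_measurable [measurable]: "half_open a b \<in> sets borel"
  by (simp add: half_open_def)

text \<open>Since the partition points exceed \<open>t\<close> from some index on, that index serves for all paths at
  once; this allows a comparison of the sums for \<open>x\<close> and \<open>f \<circ> x\<close> term by term.\<close>

lemma discrete_local_time_finite_sum:
  assumes \<pi>: "is_partition \<pi>" and t: "0 \<le> t"
  obtains N where "\<And>y u. discrete_local_time \<pi> y t u =
    2 * (\<Sum>j<N. indicator (half_open (y (stopped \<pi> t j)) (y (stopped \<pi> t (Suc j)))) u
               * \<bar>y (stopped \<pi> t (Suc j)) - u\<bar>)"
proof -
  have "\<forall>\<^sub>F j in sequentially. ennreal t < \<pi> j"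
    using \<pi> by (intro order_tendstoD(1)[of \<pi> \<infinity>]) (auto simp: is_partition_def)
  then obtain N where N: "\<And>j. N \<le> j \<Longrightarrow> ennreal t < \<pi> j"
    unfolding eventually_sequentially by blast
  have st: "stopped \<pi> t j = t" if "N \<le> j" for j
    using N[OF that] t by (simp add: stopped_def min_absorb2 less_imp_le)
  show ?thesis
  proof (rule that[of N])
    fix y u
    have "(\<Sum>j. indicator (half_open (y (stopped \<pi> t j)) (y (stopped \<pi> t (Suc j)))) u
               * \<bar>y (stopped \<pi> t (Suc j)) - u\<bar>)
        = (\<Sum>j<N. indicator (half_open (y (stopped \<pi> t j)) (y (stopped \<pi> t (Suc j)))) u
               * \<bar>y (stopped \<pi> t (Suc j)) - u\<bar>)"
      by (rule suminf_finite) (auto simp: st)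
    then show "discrete_local_time \<pi> y t u =
      2 * (\<Sum>j<N. indicator (half_open (y (stopped \<pi> t j)) (y (stopped \<pi> t (Suc j)))) u
               * \<bar>y (stopped \<pi> t (Suc j)) - u\<bar>)"
      by (simp add: discrete_local_time_def)
  qed
qed

lemma bounded_support_Lp:
  assumes [measurable]: "h \<in> borel_measurable borel"
    and h: "\<And>u. \<bar>h u\<bar> \<le> C * indicator {- c..c} u"
  shows "h \<in> Lp p"
proof (cases "p = \<infinity>")
  case True
  have "\<bar>h u\<bar> \<le> \<bar>C\<bar>" for u
    using h[of u] by (cases "u \<in> {- c..c}") auto
  then have "AE u in lborel. \<bar>h u\<bar> \<le> \<bar>C\<bar>"
    by simp
  then show ?thesis
    using True by (auto simp: Lp_def)
next
  case False
  have "integrable lborel (\<lambda>u. \<bar>h u\<bar> powr enn2real p)"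
  proof (rule Bochner_Integration.integrable_bound)
    show "integrable lborel (\<lambda>u. \<bar>C\<bar> powr enn2real p * indicator {- c..c} u)"
      by (intro integrable_mult_right integrable_real_indicator) (auto simp: emeasure_lborel_Icc_eq)
    show "AE u in lborel. norm (\<bar>h u\<bar> powr enn2real p)
        \<le> norm (\<bar>C\<bar> powr enn2real p * indicator {- c..c} u)"
    proof (intro AE_I2)
      fix u
      show "norm (\<bar>h u\<bar> powr enn2real p) \<le> norm (\<bar>C\<bar> powr enn2real p * indicator {- c..c} u)"
        using h[of u] by (cases "u \<in> {- c..c}") (auto intro!: powr_mono2)
    qed
  qed measurable
  then show ?thesis
    using False by (simp add: Lp_finite_iff)
qed

lemma discrete_local_time_Lp:
  assumes \<pi>: "is_partition \<pi>" and t: "0 \<le> t"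
    and c: "\<And>s. s \<in> {0..t} \<Longrightarrow> \<bar>y s\<bar> \<le> c"
  shows "discrete_local_time \<pi> y t \<in> Lp p"
proof -
  obtain N where N: "\<And>y u. discrete_local_time \<pi> y t u =
    2 * (\<Sum>j<N. indicator (half_open (y (stopped \<pi> t j)) (y (stopped \<pi> t (Suc j)))) u
               * \<bar>y (stopped \<pi> t (Suc j)) - u\<bar>)"
    using discrete_local_time_finite_sum[OF \<pi> t] by blast
  let ?T = "\<lambda>j u. indicator (half_open (y (stopped \<pi> t j)) (y (stopped \<pi> t (Suc j)))) u
               * \<bar>y (stopped \<pi> t (Suc j)) - u\<bar>"
  have T: "0 \<le> ?T j u" "?T j u \<le> 2 * c * indicator {- c..c} u" for j u
  proof -
    have "\<bar>y (stopped \<pi> t j)\<bar> \<le> c" "\<bar>y (stopped \<pi> t (Suc j))\<bar> \<le> c"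
      using c stopped_in[OF t] by blast+
    then show "?T j u \<le> 2 * c * indicator {- c..c} u"
      by (auto simp: half_open_def indicator_def)
  qed simp
  show ?thesis
  proof (rule bounded_support_Lp)
    show "discrete_local_time \<pi> y t \<in> borel_measurable borel"
      unfolding N[abs_def] by measurable
    fix u
    have "0 \<le> (\<Sum>j<N. ?T j u)"
      using T(1) by (rule sum_nonneg)
    moreover have "(\<Sum>j<N. ?T j u) \<le> real N * (2 * c * indicator {- c..c} u)"
      using sum_mono[of "{..<N}" "\<lambda>j. ?T j u", OF T(2)] by simp
    ultimately show "\<bar>discrete_local_time \<pi> y t u\<bar> \<le> (2 * real N * (2 * c)) * indicator {- c..c} u"
      unfolding N by linarith
  qed
qed

lemma discrete_local_time_nonneg:
  assumes "is_partition \<pi>" "0 \<le> t"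
  shows "0 \<le> discrete_local_time \<pi> y t u"
proof -
  obtain N where N: "\<And>y u. discrete_local_time \<pi> y t u =
    2 * (\<Sum>j<N. indicator (half_open (y (stopped \<pi> t j)) (y (stopped \<pi> t (Suc j)))) u
               * \<bar>y (stopped \<pi> t (Suc j)) - u\<bar>)"
    using discrete_local_time_finite_sum[OF assms] by blast
  show ?thesis
    unfolding N by (simp add: sum_nonneg)
qed

lemma continuous_path_bounded:
  fixes x :: "real \<Rightarrow> real"
  assumes "continuous_on {0..} x"
  obtains c where "\<And>s. s \<in> {0..t} \<Longrightarrow> \<bar>x s\<bar> \<le> c"
proof -
  have "continuous_on {0..t} x"
    using assms by (rule continuous_on_subset) auto
  then show ?thesis
    using that by (rule continuous_on_Icc_bounded)
qed

lemma osc_upper: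
  assumes "continuous_on {0..} x" "a \<in> {0..t}" "b \<in> {0..t}"
    and "\<pi> k \<le> ennreal a" "ennreal a < \<pi> (Suc k)" "\<pi> k \<le> ennreal b" "ennreal b < \<pi> (Suc k)"
  shows "\<bar>x b - x a\<bar> \<le> osc t x \<pi>"
proof -
  obtain c where c: "\<And>s. s \<in> {0..t} \<Longrightarrow> \<bar>x s\<bar> \<le> c"
    using continuous_path_bounded[OF assms(1)] by blast
  show ?thesis
    unfolding osc_def
  proof (rule cSup_upper)
    show "bdd_above {\<bar>x b - x a\<bar> |a b. \<exists>k. \<forall>s\<in>{a, b}. 0 \<le> s \<and> s \<le> t \<and> \<pi> k \<le> ennreal s \<and> ennreal s < \<pi> (Suc k)}"
    proof (rule bdd_aboveI)
      fix z assume "z \<in> {\<bar>x b - x a\<bar> |a b. \<exists>k. \<forall>s\<in>{a, b}. 0 \<le> s \<and> s \<le> t \<and> \<pi> k \<le> ennreal s \<and> ennreal s < \<pi> (Suc k)}"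
      then obtain a b where "z = \<bar>x b - x a\<bar>" "a \<in> {0..t}" "b \<in> {0..t}" by auto
      then show "z \<le> c + c" using c[of a] c[of b] by linarith
    qed
  qed (use assms in auto)
qed

lemma partition_start:
  assumes "is_partition \<pi>"
  shows "\<pi> 0 = 0" "0 < \<pi> (Suc 0)"
proof -
  show 0: "\<pi> 0 = 0"
    using assms by (simp add: is_partition_def)
  show "0 < \<pi> (Suc 0)"
  proof (cases "\<pi> (Suc 0) < \<infinity>")
    case True
    then have "\<pi> 0 < \<pi> (Suc 0)"
      using assms unfolding is_partition_def by blast
    then show ?thesis using 0 by simp
  next
    case False
    then show ?thesis by (metis gr_zeroI ennreal_zero_less_top infinity_ennreal_def)
  qed
qed

lemma osc_least:
  assumes \<pi>: "is_partition \<pi>" and t: "0 \<le> t"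
    and "\<And>a b k. \<lbrakk>a \<in> {0..t}; b \<in> {0..t}; \<pi> k \<le> ennreal a; ennreal a < \<pi> (Suc k);
      \<pi> k \<le> ennreal b; ennreal b < \<pi> (Suc k)\<rbrakk> \<Longrightarrow> \<bar>x b - x a\<bar> \<le> e"
  shows "osc t x \<pi> \<le> e"
  unfolding osc_def
proof (rule cSup_least)
  note partition_start[OF \<pi>]
  then show "{\<bar>x b - x a\<bar> |a b. \<exists>k. \<forall>s\<in>{a, b}. 0 \<le> s \<and> s \<le> t \<and> \<pi> k \<le> ennreal s \<and> ennreal s < \<pi> (Suc k)} \<noteq> {}"
    using t by (auto intro!: exI[of _ 0])
qed (use assms in auto)

lemma osc_nonneg:
  assumes \<pi>: "is_partition \<pi>" and t: "0 \<le> t" and x: "continuous_on {0..} x"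
  shows "0 \<le> osc t x \<pi>"
proof -
  note partition_start[OF \<pi>]
  then show ?thesis
    using osc_upper[OF x, of 0 t 0 \<pi> 0] t by simp
qed

text \<open>The oscillation only sees half-open partition intervals; the right end point is reached by
  continuity.\<close>

lemma increment_le_osc:
  assumes \<pi>: "is_partition \<pi>" and t: "0 \<le> t" and x: "continuous_on {0..} x"
  shows "\<bar>x (stopped \<pi> t (Suc j)) - x (stopped \<pi> t j)\<bar> \<le> osc t x \<pi>"
proof (cases "stopped \<pi> t j < stopped \<pi> t (Suc j)")
  case True
  let ?a = "stopped \<pi> t j" and ?b = "stopped \<pi> t (Suc j)"
  have a: "0 \<le> ?a" "?b \<le> t"
    using stopped_in[OF t] by auto
  have "ennreal ?a < ennreal ?b"
    using True a by (simp add: ennreal_less_iff)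
  then have lt: "min (\<pi> j) (ennreal t) < min (\<pi> (Suc j)) (ennreal t)"
    by (simp add: stopped_ennreal[OF t])
  then have ja: "\<pi> j = ennreal ?a"
    by (simp add: stopped_ennreal[OF t] min_def split: if_splits)
  have bj: "ennreal ?b \<le> \<pi> (Suc j)"
    by (simp add: stopped_ennreal[OF t])
  have step: "\<bar>x s - x ?a\<bar> \<le> osc t x \<pi>" if s: "s \<in> {?a<..<?b}" for s
  proof (rule osc_upper[OF x])
    have "ennreal s < ennreal ?b" "ennreal ?a < ennreal ?b"
      using s a by (auto simp: ennreal_less_iff)
    then show "ennreal s < \<pi> (Suc j)" "ennreal ?a < \<pi> (Suc j)"
      using bj by (auto intro: less_le_trans)
    show "\<pi> j \<le> ennreal s" "\<pi> j \<le> ennreal ?a"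
      using s by (auto simp: ja intro!: ennreal_leI)
  qed (use s a True in auto)
  have cl: "closure {?a<..<?b} = {?a..?b}"
    using True by (simp add: closure_greaterThanLessThan)
  show ?thesis
  proof (rule continuous_le_on_closure[where S = "{?a<..<?b}" and f = "\<lambda>s. \<bar>x s - x ?a\<bar>"])
    show "continuous_on (closure {?a<..<?b}) (\<lambda>s. \<bar>x s - x ?a\<bar>)"
      unfolding cl using a by (intro continuous_intros continuous_on_subset[OF x]) auto
  qed (use step cl True in auto)
next
  case False
  have "\<pi> j \<le> \<pi> (Suc j)"
    using \<pi> unfolding is_partition_def
    by (metis infinity_ennreal_def order_less_imp_le top.not_eq_extremum top_greatest)
  then have "ennreal (stopped \<pi> t j) \<le> ennreal (stopped \<pi> t (Suc j))"
    unfolding stopped_ennreal[OF t] by (rule min.mono) simp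
  moreover have "0 \<le> stopped \<pi> t (Suc j)"
    using stopped_in[OF t] by auto
  ultimately have "stopped \<pi> t j = stopped \<pi> t (Suc j)"
    using False by (simp add: ennreal_le_iff)
  then show ?thesis
    using osc_nonneg[OF \<pi> t x] by simp
qed

lemma osc_compose_tendsto_zero:
  fixes f :: "real \<Rightarrow> real"
  assumes \<pi>s: "\<And>n. is_partition (\<pi>s n)" and t: "0 \<le> t" and x: "continuous_on {0..} x"
    and f: "continuous_on UNIV f" and lim: "(\<lambda>n. osc t x (\<pi>s n)) \<longlonglongrightarrow> 0"
  shows "(\<lambda>n. osc t (f \<circ> x) (\<pi>s n)) \<longlonglongrightarrow> 0"
proof (rule LIMSEQ_I)
  fix e :: real assume e: "0 < e"
  obtain c where c: "\<And>s. s \<in> {0..t} \<Longrightarrow> \<bar>x s\<bar> \<le> c"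
    using continuous_path_bounded[OF x] by blast
  have fx: "continuous_on {0..} (f \<circ> x)"
    using continuous_on_compose2[OF f x] by (simp add: comp_def)
  have "uniformly_continuous_on {- c..c} f"
    using f by (intro compact_uniformly_continuous) (auto intro: continuous_on_subset)
  then obtain d where d: "0 < d"
    "\<And>a b. a \<in> {- c..c} \<Longrightarrow> b \<in> {- c..c} \<Longrightarrow> \<bar>b - a\<bar> < d \<Longrightarrow> \<bar>f b - f a\<bar> < e / 2"
    using e unfolding uniformly_continuous_on_def dist_real_def by (metis half_gt_zero)
  obtain n0 where n0: "\<And>n. n0 \<le> n \<Longrightarrow> osc t x (\<pi>s n) < d"
    using LIMSEQ_D[OF lim d(1)] by force
  have "norm (osc t (f \<circ> x) (\<pi>s n) - 0) < e" if n: "n0 \<le> n" for n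
  proof -
    have "osc t (f \<circ> x) (\<pi>s n) \<le> e / 2"
    proof (rule osc_least[OF \<pi>s t])
      fix a b k
      assume ab: "a \<in> {0..t}" "b \<in> {0..t}" "\<pi>s n k \<le> ennreal a" "ennreal a < \<pi>s n (Suc k)"
        "\<pi>s n k \<le> ennreal b" "ennreal b < \<pi>s n (Suc k)"
      then have "\<bar>x b - x a\<bar> < d"
        using osc_upper[OF x ab] n0[OF n] by simp
      then show "\<bar>(f \<circ> x) b - (f \<circ> x) a\<bar> \<le> e / 2"
        using d(2)[of "x a" "x b"] c[OF ab(1)] c[OF ab(2)] by (simp add: abs_le_iff)
    qed
    then show ?thesis
      using osc_nonneg[OF \<pi>s t fx, of n] e by simp
  qed
  then show "\<exists>n0. \<forall>n\<ge>n0. norm (osc t (f \<circ> x) (\<pi>s n) - 0) < e"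
    by blast
qed

section \<open>Local times under a change of scale\<close>

context C1_strictly_monotone
begin

text \<open>A decreasing \<open>f\<close> exchanges the closed and the open end of the interval, hence the exclusion of
  the end points.\<close>

lemma half_open_image_iff:
  assumes "u \<noteq> a" "u \<noteq> b"
  shows "f u \<in> half_open (f a) (f b) \<longleftrightarrow> u \<in> half_open a b"
  using monotone
proof
  assume "strict_mono f"
  then show ?thesis
    by (simp add: half_open_def strict_mono_less_eq strict_mono_less)
next
  assume "strict_antimono_on UNIV f"
  then have lt: "f v < f u \<longleftrightarrow> u < v" for u v
    by (metis UNIV_I linorder_less_linear monotone_onD order_less_asym order_less_irrefl)
  then have "f v \<le> f u \<longleftrightarrow> u \<le> v" for u v
    by (simp add: not_less[symmetric])
  then show ?thesis
    using assms lt by (auto simp: half_open_def)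
qed

lemma half_open_image_subset:
  assumes "a \<in> {- c..c}" "b \<in> {- c..c}"
  shows "half_open (f a) (f b) \<subseteq> f ` {- c..c}"
proof -
  have "connected (f ` {- c..c})"
    by (intro connected_continuous_image cont) simp
  then have *: "{f d..f e} \<subseteq> f ` {- c..c}" if "d \<in> {- c..c}" "e \<in> {- c..c}" for d e
    using that by (rule connected_contains_Icc[OF _ imageI imageI])
  have "half_open (f a) (f b) \<subseteq> {f a..f b} \<union> {f b..f a}"
    by (auto simp: half_open_def)
  then show ?thesis
    using *[OF assms] *[OF assms(2,1)] by blast
qed

lemma mean_value: "\<exists>\<xi>. \<bar>\<xi> - u\<bar> \<le> \<bar>b - u\<bar> \<and> \<xi> \<in> {min u b..max u b} \<and> f b - f u = D \<xi> * (b - u)"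
proof (cases u b rule: linorder_cases)
  case less
  then obtain z where "u < z" "z < b" "f b - f u = (b - u) * D z"
    using MVT2[OF less, of f D] deriv by blast
  then show ?thesis using less by (intro exI[of _ z]) auto
next
  case equal
  then show ?thesis by auto
next
  case greater
  then obtain z where "b < z" "z < u" "f u - f b = (u - b) * D z"
    using MVT2[OF greater, of f D] deriv by blast
  then show ?thesis using greater by (intro exI[of _ z]) (auto simp: algebra_simps)
qed

text \<open>If \<open>u\<close> lies between two successive path values, then
  \<open>\<bar>f b - f u\<bar> = \<bar>D \<xi>\<bar> * \<bar>b - u\<bar>\<close>, where \<open>\<xi>\<close> differs from \<open>u\<close> by at most the
  oscillation of the path. So replacing \<open>D \<xi>\<close> by \<open>D u\<close> costs at most \<open>\<epsilon> * \<bar>b - u\<bar>\<close> in each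
  term, and these errors add up to at most \<open>\<epsilon>\<close> times the discrete local time of \<open>x\<close>.
  The transport with weight \<open>1\<close> states this bound in the variable \<open>v = f u\<close>.\<close>

lemma discrete_local_time_compose:
  assumes \<pi>: "is_partition \<pi>" and t: "0 \<le> t" and x: "continuous_on {0..} x"
    and c: "\<And>s. s \<in> {0..t} \<Longrightarrow> \<bar>x s\<bar> \<le> c"
    and \<delta>: "\<And>a b. \<lbrakk>a \<in> {- c..c}; b \<in> {- c..c}; \<bar>b - a\<bar> < \<delta>\<rbrakk> \<Longrightarrow> \<bar>D b - D a\<bar> < \<epsilon>"
    and osc: "osc t x \<pi> < \<delta>"
  shows "AE v in lborel. \<bar>discrete_local_time \<pi> (f \<circ> x) t v
      - pushforward (\<lambda>u. \<bar>D u\<bar>) c (discrete_local_time \<pi> x t) v\<bar>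
    \<le> \<epsilon> * pushforward (\<lambda>_. 1) c (discrete_local_time \<pi> x t) v"
proof -
  obtain N where N: "\<And>y u. discrete_local_time \<pi> y t u =
    2 * (\<Sum>j<N. indicator (half_open (y (stopped \<pi> t j)) (y (stopped \<pi> t (Suc j)))) u
               * \<bar>y (stopped \<pi> t (Suc j)) - u\<bar>)"
    using discrete_local_time_finite_sum[OF \<pi> t] by blast
  define X where "X j = x (stopped \<pi> t j)" for j
  have X: "X j \<in> {- c..c}" for j
    using c[OF stopped_in[OF t], of \<pi> j] by (auto simp: X_def)
  have dX: "\<bar>X (Suc j) - X j\<bar> < \<delta>" for j
    using increment_le_osc[OF \<pi> t x, of j] osc by (simp add: X_def)
  \<comment> \<open>the countably many end points, where the half-open intervals may disagree\<close>
  have "AE v in lborel. v \<notin> range (\<lambda>j. f (X j))"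
    by (intro AE_not_in countable_imp_null_set_lborel) simp
  then show ?thesis
  proof eventually_elim
    case (elim v)
    show ?case
    proof (cases "v \<in> f ` {- c..c}")
      case False
      then have "v \<notin> half_open (f (X j)) (f (X (Suc j)))" for j
        using half_open_image_subset[OF X X] by blast
      then show ?thesis
        using False by (simp add: N pushforward_outside X_def)
    next
      case True
      then obtain u where u: "u \<in> {- c..c}" "v = f u" by blast
      let ?F = "\<lambda>j. indicator (half_open (f (X j)) (f (X (Suc j)))) (f u) * \<bar>f (X (Suc j)) - f u\<bar>"
      let ?X = "\<lambda>j. indicator (half_open (X j) (X (Suc j))) u * \<bar>X (Suc j) - u\<bar>"
      have ne: "u \<noteq> X j" for j
        using elim u by blast
      have main: "\<bar>?F j - \<bar>D u\<bar> * ?X j\<bar> \<le> \<epsilon> * ?X j" for j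
      proof (cases "u \<in> half_open (X j) (X (Suc j))")
        case True
        obtain \<xi> where \<xi>: "\<bar>\<xi> - u\<bar> \<le> \<bar>X (Suc j) - u\<bar>" "\<xi> \<in> {min u (X (Suc j))..max u (X (Suc j))}"
          "f (X (Suc j)) - f u = D \<xi> * (X (Suc j) - u)"
          using mean_value by blast
        have "\<bar>X (Suc j) - u\<bar> \<le> \<bar>X (Suc j) - X j\<bar>"
          using True by (auto simp: half_open_def split: if_splits)
        then have "\<bar>\<xi> - u\<bar> < \<delta>"
          using \<xi>(1) dX[of j] by linarith
        moreover have "\<xi> \<in> {- c..c}"
          using \<xi>(2) u X[of "Suc j"] by auto
        ultimately have "\<bar>D \<xi> - D u\<bar> < \<epsilon>"
          using \<delta> u(1) by blast
        then have "\<bar>\<bar>D \<xi>\<bar> - \<bar>D u\<bar>\<bar> \<le> \<epsilon>"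
          by linarith
        then have "\<bar>\<bar>D \<xi>\<bar> - \<bar>D u\<bar>\<bar> * \<bar>X (Suc j) - u\<bar> \<le> \<epsilon> * \<bar>X (Suc j) - u\<bar>"
          by (rule mult_right_mono) simp
        moreover have "\<bar>f (X (Suc j)) - f u\<bar> - \<bar>D u\<bar> * \<bar>X (Suc j) - u\<bar>
            = (\<bar>D \<xi>\<bar> - \<bar>D u\<bar>) * \<bar>X (Suc j) - u\<bar>"
          unfolding \<xi>(3) abs_mult by (simp add: left_diff_distrib)
        ultimately have "\<bar>\<bar>f (X (Suc j)) - f u\<bar> - \<bar>D u\<bar> * \<bar>X (Suc j) - u\<bar>\<bar>
            \<le> \<epsilon> * \<bar>X (Suc j) - u\<bar>"
          by (simp add: abs_mult)
        then show ?thesis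
          using True ne half_open_image_iff[of u "X j" "X (Suc j)"] by simp
      next
        case False
        then show ?thesis
          using ne half_open_image_iff[of u "X j" "X (Suc j)"] by simp
      qed
      have "\<bar>(\<Sum>j<N. ?F j) - \<bar>D u\<bar> * (\<Sum>j<N. ?X j)\<bar> = \<bar>\<Sum>j<N. ?F j - \<bar>D u\<bar> * ?X j\<bar>"
        by (simp only: sum_subtractf sum_distrib_left)
      also have "\<dots> \<le> (\<Sum>j<N. \<bar>?F j - \<bar>D u\<bar> * ?X j\<bar>)"
        by (rule sum_abs)
      also have "\<dots> \<le> \<epsilon> * (\<Sum>j<N. ?X j)"
        unfolding sum_distrib_left by (intro sum_mono main)
      finally show ?thesis
        using u by (simp add: N pushforward_apply X_def[symmetric])
    qed
  qed
qed

lemma discrete_local_time_compose_weak_lim: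
  assumes p: "1 \<le> p" and \<pi>s: "\<And>n. is_partition (\<pi>s n)" and t: "0 \<le> t"
    and x: "continuous_on {0..} x" and osc: "(\<lambda>n. osc t x (\<pi>s n)) \<longlonglongrightarrow> 0"
    and c: "\<And>s. s \<in> {0..t} \<Longrightarrow> \<bar>x s\<bar> \<le> c"
    and lim: "Lp_weak_lim p (\<lambda>n. discrete_local_time (\<pi>s n) x t) l"
  shows "Lp_weak_lim p (\<lambda>n. discrete_local_time (\<pi>s n) (f \<circ> x) t) (pushforward (\<lambda>u. \<bar>D u\<bar>) c l)"
proof -
  let ?H = "\<lambda>n. discrete_local_time (\<pi>s n) x t"
  let ?F = "\<lambda>n. discrete_local_time (\<pi>s n) (f \<circ> x) t"
  have c0: "0 \<le> c"
    using c[of 0] t by auto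
  have HLp: "?H n \<in> Lp p" and lLp: "l \<in> Lp p" for n
    using lim by (auto simp: Lp_weak_lim_def)
  have w: "continuous_on UNIV (\<lambda>u. \<bar>D u\<bar>)" "continuous_on UNIV (\<lambda>_::real. 1::real)"
    using cont_deriv by (auto intro: continuous_intros)
  have TH: "Lp_weak_lim p (\<lambda>n. pushforward v c (?H n)) (pushforward v c l)"
    if v: "continuous_on UNIV v" for v
    unfolding Lp_weak_lim_def
  proof (intro conjI allI ballI)
    show "pushforward v c (?H n) \<in> Lp p" "pushforward v c l \<in> Lp p" for n
      using pushforward_Lp[OF c0 v p] HLp lLp by auto
    show "(\<lambda>n. \<phi> (pushforward v c (?H n))) \<longlonglongrightarrow> \<phi> (pushforward v c l)"
      if "\<phi> \<in> Lp_functionals p" for \<phi>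
    proof -
      have "\<forall>\<psi>\<in>Lp_functionals p. (\<lambda>n. \<psi> (?H n)) \<longlonglongrightarrow> \<psi> l"
        using lim by (simp add: Lp_weak_lim_def)
      then show ?thesis
        using pushforward_functional[OF c0 v p that] by (rule bspec)
    qed
  qed
  have "continuous_on {0..} (f \<circ> x)"
    using continuous_on_compose2[OF cont[of UNIV] x] by (simp add: comp_def)
  then obtain c' where "\<And>s. s \<in> {0..t} \<Longrightarrow> \<bar>(f \<circ> x) s\<bar> \<le> c'"
    using continuous_path_bounded by blast
  then have FLp: "?F n \<in> Lp p" for n
    using discrete_local_time_Lp[OF \<pi>s t] by blast
  define E where "E n v = 1 * ?F n v + (-1) * pushforward (\<lambda>u. \<bar>D u\<bar>) c (?H n) v" for n v
  have ELp: "E n \<in> Lp p" for n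
    unfolding E_def[abs_def] using FLp pushforward_Lp[OF c0 w(1) p HLp] by (intro Lp_lincomb[OF p])
  have "\<forall>\<^sub>F n in sequentially. AE v in lborel. \<bar>E n v\<bar> \<le> \<epsilon> * pushforward (\<lambda>_. 1) c (?H n) v"
    if \<epsilon>: "0 < \<epsilon>" for \<epsilon>
  proof -
    have "uniformly_continuous_on {- c..c} D"
      using cont_deriv by (intro compact_uniformly_continuous) (auto intro: continuous_on_subset)
    then obtain \<delta> where \<delta>: "0 < \<delta>"
      "\<And>a b. a \<in> {- c..c} \<Longrightarrow> b \<in> {- c..c} \<Longrightarrow> \<bar>b - a\<bar> < \<delta> \<Longrightarrow> \<bar>D b - D a\<bar> < \<epsilon>"
      using \<epsilon> unfolding uniformly_continuous_on_def dist_real_def by metis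
    have "\<forall>\<^sub>F n in sequentially. osc t x (\<pi>s n) < \<delta>"
      using osc \<delta>(1) by (rule order_tendstoD)
    then show ?thesis
    proof eventually_elim
      case (elim n)
      then show ?case
        using discrete_local_time_compose[OF \<pi>s t x c \<delta>(2)] by (simp add: E_def)
    qed
  qed
  moreover have "0 \<le> pushforward (\<lambda>_. 1) c (?H n) v" for n v
    by (simp add: pushforward_def discrete_local_time_nonneg[OF \<pi>s t])
  ultimately have E0: "(\<lambda>n. \<phi> (E n)) \<longlonglongrightarrow> 0" if "\<phi> \<in> Lp_functionals p" for \<phi>
    by (intro functional_dominated_tendsto_zero[OF p TH[OF w(2)] _ ELp _ that])
  have "(\<lambda>n. \<phi> (?F n)) \<longlonglongrightarrow> \<phi> (pushforward (\<lambda>u. \<bar>D u\<bar>) c l)" if \<phi>: "\<phi> \<in> Lp_functionals p" for \<phi>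
  proof -
    have "\<phi> (?F n) = \<phi> (E n) + \<phi> (pushforward (\<lambda>u. \<bar>D u\<bar>) c (?H n))" for n
      using functional_lincomb[OF \<phi> p FLp[of n] pushforward_Lp[OF c0 w(1) p HLp[of n]], of 1 "-1"]
      by (simp add: E_def[abs_def])
    moreover have "(\<lambda>n. \<phi> (pushforward (\<lambda>u. \<bar>D u\<bar>) c (?H n))) \<longlonglongrightarrow> \<phi> (pushforward (\<lambda>u. \<bar>D u\<bar>) c l)"
      using TH[OF w(1)] \<phi> by (simp add: Lp_weak_lim_def)
    ultimately show ?thesis
      using tendsto_add[OF E0[OF \<phi>]] by fastforce
  qed
  then show ?thesis
    using FLp pushforward_Lp[OF c0 w(1) p lLp] by (simp add: Lp_weak_lim_def)
qed

end

text \<open>The discrete local times vanish off the range of the path, that is, they are fixed by the cut-off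
  to \<open>[-c, c]\<close>. The cut-off is the transport along the identity with weight \<open>1\<close>; it is weakly
  continuous, so it fixes the limit, too.\<close>

lemma local_time_zero_outside:
  assumes p: "1 \<le> p" and \<pi>s: "\<And>n. is_partition (\<pi>s n)" and t: "0 \<le> t"
    and c: "\<And>s. s \<in> {0..t} \<Longrightarrow> \<bar>x s\<bar> \<le> c"
    and lim: "Lp_weak_lim p (\<lambda>n. discrete_local_time (\<pi>s n) x t) l"
  shows "AE u in lborel. u \<notin> {- c..c} \<longrightarrow> l u = 0"
proof -
  interpret I: C1_strictly_monotone "\<lambda>u. u" "\<lambda>_. 1"
    by unfold_locales (auto simp: strict_mono_def)
  have c0: "0 \<le> c"
    using c[of 0] t by auto
  have push: "I.pushforward (\<lambda>_. 1) c h = (\<lambda>u. indicator {- c..c} u * h u)" for h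
    using I.pushforward_apply[of "\<lambda>_. 1" c h] by auto
  have "discrete_local_time (\<pi>s n) x t u = 0" if u: "u \<notin> {- c..c}" for n u
  proof -
    have "u \<notin> half_open (x (stopped (\<pi>s n) t j)) (x (stopped (\<pi>s n) t (Suc j)))" for j
      using u c[OF stopped_in[OF t, of "\<pi>s n" j]] c[OF stopped_in[OF t, of "\<pi>s n" "Suc j"]]
      by (auto simp: half_open_def)
    then show ?thesis
      by (simp add: discrete_local_time_def)
  qed
  then have "I.pushforward (\<lambda>_. 1) c (discrete_local_time (\<pi>s n) x t) = discrete_local_time (\<pi>s n) x t" for n
    by (force simp: push indicator_def)
  then have "Lp_weak_lim p (\<lambda>n. discrete_local_time (\<pi>s n) x t) (I.pushforward (\<lambda>_. 1) c l)"
    using lim I.pushforward_functional[OF c0 _ p, of "\<lambda>_. 1"] I.pushforward_Lp[OF c0 _ p, of "\<lambda>_. 1" l]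
    unfolding Lp_weak_lim_def by fastforce
  then have "AE u in lborel. I.pushforward (\<lambda>_. 1) c l u = l u"
    using lim by (rule Lp_weak_lim_unique[OF p])
  then show ?thesis
    by eventually_elim (auto simp: push)
qed

theorem proposition4p1:
  fixes p :: ennreal and x :: "real \<Rightarrow> real" and \<pi>s :: "nat \<Rightarrow> nat \<Rightarrow> ennreal"
    and f :: "real \<Rightarrow> real"
  assumes "1 \<le> p"
    and "continuous_on {0..} x"
    and "\<And>n. is_partition (\<pi>s n)"
    and "\<And>t. 0 \<le> t \<Longrightarrow> (\<lambda>n. osc t x (\<pi>s n)) \<longlonglongrightarrow> 0"
    and "x \<in> local_time_class p \<pi>s"
    and "f C1_differentiable_on UNIV"
    and "strict_mono f \<or> strict_antimono_on UNIV f"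
  shows "f \<circ> x \<in> local_time_class p \<pi>s \<and>
    (\<forall>L K. is_local_time p \<pi>s x L \<longrightarrow> is_local_time p \<pi>s (f \<circ> x) K \<longrightarrow>
      (\<forall>t\<ge>0. \<exists>M\<in>Lp p. (AE v in lborel. M v = K t v) \<and>
        (AE u in lborel. M (f u) = \<bar>deriv f u\<bar> * L t u)))"
proof -
  note p = assms(1) and x = assms(2) and \<pi>s = assms(3) and osc = assms(4)
  obtain D where D: "\<And>u. (f has_vector_derivative D u) (at u)" "continuous_on UNIV D"
    using assms(6) by (auto simp: C1_differentiable_on_def)
  interpret C1_strictly_monotone f D
    using D assms(7)
    by unfold_locales (auto simp: has_real_derivative_iff_has_vector_derivative)
  have derivD: "deriv f u = D u" for u
    by (rule DERIV_imp_deriv[OF deriv])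
  have w: "continuous_on UNIV (\<lambda>u. \<bar>D u\<bar>)"
    using cont_deriv by (intro continuous_intros)
  have "\<exists>c. \<forall>s\<in>{0..t}. \<bar>x s\<bar> \<le> c" for t
    using continuous_path_bounded[OF x] by metis
  then obtain c where c: "\<And>t s. s \<in> {0..t} \<Longrightarrow> \<bar>x s\<bar> \<le> c t"
    by metis
  have c0: "0 \<le> c t" if "0 \<le> t" for t
    using c[of 0 t] that by auto
  have lim: "Lp_weak_lim p (\<lambda>n. discrete_local_time (\<pi>s n) (f \<circ> x) t)
      (pushforward (\<lambda>u. \<bar>D u\<bar>) (c T) (L t))"
    if "is_local_time p \<pi>s x L" "0 \<le> t" "t \<le> T" for L t T
  proof (rule discrete_local_time_compose_weak_lim[OF p \<pi>s that(2) x osc])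
    show "\<bar>x s\<bar> \<le> c T" if "s \<in> {0..t}" for s
      using that \<open>t \<le> T\<close> by (intro c) auto
  qed (use that in \<open>auto simp: is_local_time_def\<close>)
  obtain L where L: "is_local_time p \<pi>s x L"
    using assms(5) by (auto simp: local_time_class_def)
  define K where "K t = pushforward (\<lambda>u. \<bar>D u\<bar>) (c t) (L t)" for t
  have "continuous_on {0..} (\<lambda>t. \<phi> (K t))" if \<phi>: "\<phi> \<in> Lp_functionals p" for \<phi>
    unfolding continuous_on_eq_continuous_within
  proof
    fix t :: real assume t: "t \<in> {0..}"
    \<comment> \<open>near \<open>t\<close> one fixed cut-off serves for all times, which makes \<open>\<phi> (K s)\<close> one functional of \<open>L s\<close>\<close>
    let ?T = "t + 1"
    have "\<forall>\<psi>\<in>Lp_functionals p. continuous_on {0..} (\<lambda>t. \<psi> (L t))"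
      using L by (simp add: is_local_time_def)
    moreover have "(\<lambda>h. \<phi> (pushforward (\<lambda>u. \<bar>D u\<bar>) (c ?T) h)) \<in> Lp_functionals p"
      using t by (intro pushforward_functional[OF c0 w p \<phi>]) auto
    ultimately have "continuous_on {0..} (\<lambda>s. \<phi> (pushforward (\<lambda>u. \<bar>D u\<bar>) (c ?T) (L s)))"
      by (rule bspec)
    then have "continuous_on {0..?T} (\<lambda>s. \<phi> (pushforward (\<lambda>u. \<bar>D u\<bar>) (c ?T) (L s)))"
      by (rule continuous_on_subset) auto
    \<comment> \<open>both sides are the limit of the same sequence\<close>
    moreover have "\<phi> (pushforward (\<lambda>u. \<bar>D u\<bar>) (c ?T) (L s)) = \<phi> (K s)" if "s \<in> {0..?T}" for s
    proof (rule LIMSEQ_unique)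
      show "(\<lambda>n. \<phi> (discrete_local_time (\<pi>s n) (f \<circ> x) s))
          \<longlonglongrightarrow> \<phi> (pushforward (\<lambda>u. \<bar>D u\<bar>) (c ?T) (L s))"
        using lim[OF L, of s ?T] that \<phi> by (simp add: Lp_weak_lim_def)
      show "(\<lambda>n. \<phi> (discrete_local_time (\<pi>s n) (f \<circ> x) s)) \<longlonglongrightarrow> \<phi> (K s)"
        using lim[OF L, of s s] that \<phi> by (simp add: Lp_weak_lim_def K_def)
    qed
    ultimately have "continuous_on {0..?T} (\<lambda>s. \<phi> (K s))"
      by (rule continuous_on_eq)
    then have "continuous (at t within {0..?T}) (\<lambda>s. \<phi> (K s))"
      using t by (auto simp: continuous_on_eq_continuous_within)
    moreover have "at t within {0..?T} = at t within {0..}"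
      by (rule at_within_nhd[of _ "{..<?T}"]) auto
    ultimately show "continuous (at t within {0..}) (\<lambda>s. \<phi> (K s))"
      by simp
  qed
  moreover have "continuous_on {0..} (f \<circ> x)"
    using continuous_on_compose2[OF cont[of UNIV] x] by (simp add: comp_def)
  moreover have "(\<lambda>n. osc t (f \<circ> x) (\<pi>s n)) \<longlonglongrightarrow> 0" if "0 \<le> t" for t
    using osc_compose_tendsto_zero[OF \<pi>s that x cont osc[OF that]] by simp
  ultimately have "is_local_time p \<pi>s (f \<circ> x) K"
    using lim[OF L] unfolding is_local_time_def K_def by blast
  then have "f \<circ> x \<in> local_time_class p \<pi>s"
    by (auto simp: local_time_class_def)
  moreover have "\<exists>M\<in>Lp p. (AE v in lborel. M v = K t v) \<and>
      (AE u in lborel. M (f u) = \<bar>deriv f u\<bar> * L t u)"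
    if L: "is_local_time p \<pi>s x L" and K: "is_local_time p \<pi>s (f \<circ> x) K" and t: "0 \<le> t" for L K t
  proof (intro bexI conjI)
    let ?M = "pushforward (\<lambda>u. \<bar>D u\<bar>) (c t) (L t)"
    have M: "Lp_weak_lim p (\<lambda>n. discrete_local_time (\<pi>s n) (f \<circ> x) t) ?M"
      using lim[OF L t] by simp
    then show "?M \<in> Lp p"
      by (simp add: Lp_weak_lim_def)
    have "Lp_weak_lim p (\<lambda>n. discrete_local_time (\<pi>s n) (f \<circ> x) t) (K t)"
      using K t by (simp add: is_local_time_def)
    with M show "AE v in lborel. ?M v = K t v"
      by (rule Lp_weak_lim_unique[OF p])
    have "AE u in lborel. u \<notin> {- c t..c t} \<longrightarrow> L t u = 0"
      using L t by (intro local_time_zero_outside[OF p \<pi>s t c]) (auto simp: is_local_time_def)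
    then show "AE u in lborel. ?M (f u) = \<bar>deriv f u\<bar> * L t u"
      by eventually_elim (auto simp: pushforward_apply derivD indicator_def)
  qed
  ultimately show ?thesis by blast
qed

end
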